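(* The system $(Z,F)$ (constructed in the context from an irrational circle rotation) is minimal. Its set of Li–Yorke pairs is the countable collection consisting of the $F\times F$-orbits of the two pairs $(z^{+0},z^-)$ and $(z^{+1},z^-)$, and $(Z,F)$ contains no strong Li–Yorke pairs.
   Context: Let $\mathbb S=\mathbb R/\mathbb Z$, identified with $[0,1)$; $\{t\}$ denotes the fractional part of $t$. Fix an irrational $\alpha\in[0,1)$ and let $R_\alpha(t)=\{t+\alpha\}$. Let $n_0=1$ and let $(n_i)_{i\ge1}$ be an increasing sequence of positive integers such that $(\{n_j\alpha\})_{j\ge1}$ is a (strictly) decreasing sequence in the unit interval converging to $\alpha$. Choose $\beta^1$ with $\{n_1\alpha\}<\beta^1<1$ and $\beta^1$ not a rational linear combination of $1$ and $\alpha$; inductively, for $j>1$, choose $\beta^j$ rationally independent of $1$, $\alpha$ and the $\beta^k$, $k<j$ (i.e. not a rational linear combination of them), with $\{n_j\alpha\}<\beta^j<\{n_{j-1}\alpha\}$. Let $I_j=[\{n_j\alpha\},\beta^j]$ for $j\ge1$ and $K=\{\alpha\}\cup\bigcup_{j\ge1}I_j$, regarded as a closed subset of $\mathbb S$. Let $c_0:\mathbb S\to\{0,1\}$ be the characteristic function of $K$, $c_i=c_0\circ R_\alpha^i$ for $i\in\mathbb Z$, and $c(t)=(c_i(t))_{i\in\mathbb Z}\in\{0,1\}^{\mathbb Z}$. Let $T$ be the shift $T((x_i)_i)=(x_{i+1})_i$ on $\{0,1\}^{\mathbb Z}$. Let $Z$ be the closure of $\{(t,c(t)):t\in\mathbb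 S\}$ in $\mathbb S\times\{0,1\}^{\mathbb Z}$ and let $F:Z\to Z$ be the restriction of $R_\alpha\times T$ (a homeomorphism of $Z$). The points $z^{+1}=(\alpha,a)$, $z^{+0}=(\alpha,\bar a)$, $z^-=(\alpha,b)$ of $Z$ are given by: $a_i=\bar a_i=b_i=c_i(\alpha)$ for $i\notin\{n_j-1:j\ge0\}$; $a_i=\bar a_i=1$, $b_i=0$ for $i\in\{n_j-1:j>0\}$; and $a_0=1$, $\bar a_0=b_0=0$. (These three are exactly the points of $Z$ with first coordinate $\alpha$.) With $\varrho$ a compatible metric on $Z$, a pair $\{z,z'\}$ (unordered) is a Li–Yorke pair if $\limsup_{n\to\infty}\varrho(F^nz,F^nz')>0$ and $\liminf_{n\to\infty}\varrho(F^nz,F^nz')=0$; it is a strong Li–Yorke pair if moreover $(z,z')$ is recurrent under $F\times F$, i.e. $(F^{n_k}z,F^{n_k}z')\to(z,z')$ along some sequence $n_k\to+\infty$. The orbit of a pair is $\{(F^nz,F^nz'):n\in\mathbb Z\}$. A system is minimal if its only closed invariant subsets are $\emptyset$ and the whole space. *)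

theory Defs
  imports "HOL-Analysis.Analysis"
begin

section \<open>Generalities on dynamical systems\<close>

text \<open>Integer iterates of a bijection \<open>f\<close> of the set \<open>X\<close>.\<close>

definition int_iter :: "'a set \<Rightarrow> ('a \<Rightarrow> 'a) \<Rightarrow> int \<Rightarrow> 'a \<Rightarrow> 'a" where
  "int_iter X f i = (if 0 \<le> i then f ^^ nat i else inv_into X f ^^ nat (- i))"

definition minimal_system :: "'a topology \<Rightarrow> ('a \<Rightarrow> 'a) \<Rightarrow> bool" where
  "minimal_system X F \<longleftrightarrow>
     (\<forall>A. closedin X A \<and> F ` A \<subseteq> A \<longrightarrow> A = {} \<or> A = topspace X)"

definition compatible_metric :: "'a topology \<Rightarrow> ('a \<Rightarrow> 'a \<Rightarrow> real) \<Rightarrow> bool" where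
  "compatible_metric X \<rho> \<longleftrightarrow>
     Metric_space (topspace X) \<rho> \<and> Metric_space.mtopology (topspace X) \<rho> = X"

definition Li_Yorke :: "('a \<Rightarrow> 'a \<Rightarrow> real) \<Rightarrow> ('a \<Rightarrow> 'a) \<Rightarrow> 'a \<Rightarrow> 'a \<Rightarrow> bool" where
  "Li_Yorke \<rho> F z z' \<longleftrightarrow>
     limsup (\<lambda>n. ereal (\<rho> ((F ^^ n) z) ((F ^^ n) z'))) > 0 \<and>
     liminf (\<lambda>n. ereal (\<rho> ((F ^^ n) z) ((F ^^ n) z'))) = 0"

definition recurrent_pair :: "'a topology \<Rightarrow> ('a \<Rightarrow> 'a) \<Rightarrow> 'a \<Rightarrow> 'a \<Rightarrow> bool" where
  "recurrent_pair X F z z' \<longleftrightarrow>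
     (\<exists>k :: nat \<Rightarrow> nat. filterlim k at_top sequentially \<and>
        limitin (prod_topology X X) (\<lambda>m. ((F ^^ k m) z, (F ^^ k m) z')) (z, z') sequentially)"

definition Li_Yorke_pairs :: "'a topology \<Rightarrow> ('a \<Rightarrow> 'a \<Rightarrow> real) \<Rightarrow> ('a \<Rightarrow> 'a) \<Rightarrow> 'a set set" where
  "Li_Yorke_pairs X \<rho> F =
     {{z, z'} | z z'. z \<in> topspace X \<and> z' \<in> topspace X \<and> Li_Yorke \<rho> F z z'}"

definition strong_Li_Yorke_pairs :: "'a topology \<Rightarrow> ('a \<Rightarrow> 'a \<Rightarrow> real) \<Rightarrow> ('a \<Rightarrow> 'a) \<Rightarrow> 'a set set" where
  "strong_Li_Yorke_pairs X \<rho> F =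
     {{z, z'} | z z'. z \<in> topspace X \<and> z' \<in> topspace X \<and> Li_Yorke \<rho> F z z' \<and>
        recurrent_pair X F z z'}"

definition pair_orbit :: "'a set \<Rightarrow> ('a \<Rightarrow> 'a) \<Rightarrow> 'a \<Rightarrow> 'a \<Rightarrow> 'a set set" where
  "pair_orbit X F z z' = {{int_iter X F i z, int_iter X F i z'} | i. True}"


section \<open>The circle, its rotations and the full two-shift\<close>

text \<open>The circle is the set \<open>{0..<1}\<close> with the quotient topology induced by
  \<open>frac\<close> from the real line.\<close>

definition circle :: "real topology" where
  "circle = topology (\<lambda>U. U \<subseteq> {0..<1} \<and> open (frac -` U))"

lemma istopology_circle: "istopology (\<lambda>U. U \<subseteq> {0..<1::real} \<and> open (frac -` U))"
  by (auto simp: istopology_def vimage_Union)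

lemma openin_circle: "openin circle U \<longleftrightarrow> U \<subseteq> {0..<1} \<and> open (frac -` U)"
  by (simp add: circle_def istopology_circle topology_inverse')

lemma topspace_circle: "topspace circle = {0..<1}"
proof -
  have "frac -` {0..<1::real} = UNIV"
    by (auto simp: frac_lt_1)
  then have "openin circle {0..<1}"
    by (simp add: openin_circle)
  moreover have "\<And>U. openin circle U \<Longrightarrow> U \<subseteq> {0..<1}"
    by (simp add: openin_circle)
  ultimately show ?thesis
    by (meson openin_subset openin_topspace subset_antisym)
qed

lemma quotient_map_circle: "quotient_map euclidean circle frac"
proof -
  have "range frac = {0..<1::real}"
  proof
    show "{0..<1::real} \<subseteq> range frac"
      by (metis atLeastLessThan_iff frac_eq rangeI subsetI)
  qed (auto simp: frac_lt_1)
  then show ?thesis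
    by (auto simp: quotient_map_def topspace_circle openin_circle vimage_def)
qed

definition rotation :: "real \<Rightarrow> real \<Rightarrow> real" where
  "rotation \<alpha> t = frac (t + \<alpha>)"

text \<open>Symbols are booleans, \<open>True\<close> standing for 1 and \<open>False\<close> for 0.\<close>

definition full_shift :: "(int \<Rightarrow> bool) topology" where
  "full_shift = product_topology (\<lambda>_. discrete_topology UNIV) UNIV"

definition shift :: "(int \<Rightarrow> bool) \<Rightarrow> int \<Rightarrow> bool" where
  "shift x = (\<lambda>i. x (i + 1))"


section \<open>The system \<open>(Z, F)\<close>\<close>

definition rat_span :: "real set \<Rightarrow> real set" where
  "rat_span = module.span (\<lambda>(q::rat) x. of_rat q * x)"

definition K_set :: "real \<Rightarrow> (nat \<Rightarrow> nat) \<Rightarrow> (nat \<Rightarrow> real) \<Rightarrow> real set" where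
  "K_set \<alpha> n \<beta> = {\<alpha>} \<union> (\<Union>j\<in>{1..}. {frac (real (n j) * \<alpha>)..\<beta> j})"

definition coding :: "real \<Rightarrow> (nat \<Rightarrow> nat) \<Rightarrow> (nat \<Rightarrow> real) \<Rightarrow> real \<Rightarrow> int \<Rightarrow> bool" where
  "coding \<alpha> n \<beta> t = (\<lambda>i. int_iter {0..<1} (rotation \<alpha>) i t \<in> K_set \<alpha> n \<beta>)"

definition Z_set :: "real \<Rightarrow> (nat \<Rightarrow> nat) \<Rightarrow> (nat \<Rightarrow> real) \<Rightarrow> (real \<times> (int \<Rightarrow> bool)) set" where
  "Z_set \<alpha> n \<beta> =
     prod_topology circle full_shift closure_of {(t, coding \<alpha> n \<beta> t) | t. t \<in> {0..<1}}"

definition Z_top :: "real \<Rightarrow> (nat \<Rightarrow> nat) \<Rightarrow> (nat \<Rightarrow> real) \<Rightarrow> (real \<times> (int \<Rightarrow> bool)) topology" where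
  "Z_top \<alpha> n \<beta> = subtopology (prod_topology circle full_shift) (Z_set \<alpha> n \<beta>)"

definition F_map :: "real \<Rightarrow> real \<times> (int \<Rightarrow> bool) \<Rightarrow> real \<times> (int \<Rightarrow> bool)" where
  "F_map \<alpha> = map_prod (rotation \<alpha>) shift"

definition special_seq :: "real \<Rightarrow> (nat \<Rightarrow> nat) \<Rightarrow> (nat \<Rightarrow> real) \<Rightarrow> bool \<Rightarrow> bool \<Rightarrow> int \<Rightarrow> bool" where
  "special_seq \<alpha> n \<beta> v\<^sub>0 v = (\<lambda>i.
     if i = int (n 0) - 1 then v\<^sub>0
     else if \<exists>j>0. i = int (n j) - 1 then v
     else coding \<alpha> n \<beta> \<alpha> i)"

definition z_plus1 :: "real \<Rightarrow> (nat \<Rightarrow> nat) \<Rightarrow> (nat \<Rightarrow> real) \<Rightarrow> real \<times> (int \<Rightarrow> bool)" where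
  "z_plus1 \<alpha> n \<beta> = (\<alpha>, special_seq \<alpha> n \<beta> True True)"

definition z_plus0 :: "real \<Rightarrow> (nat \<Rightarrow> nat) \<Rightarrow> (nat \<Rightarrow> real) \<Rightarrow> real \<times> (int \<Rightarrow> bool)" where
  "z_plus0 \<alpha> n \<beta> = (\<alpha>, special_seq \<alpha> n \<beta> False True)"

definition z_minus :: "real \<Rightarrow> (nat \<Rightarrow> nat) \<Rightarrow> (nat \<Rightarrow> real) \<Rightarrow> real \<times> (int \<Rightarrow> bool)" where
  "z_minus \<alpha> n \<beta> = (\<alpha>, special_seq \<alpha> n \<beta> False False)"

end

theory Submission
  imports Defs
begin

text \<open>
  For real \<open>u\<close> write \<open>visits u\<close> for \<open>frac u \<in> K\<close>; the symbol of \<open>t\<close> at time \<open>i\<close> is \<open>visits (t + i\<alpha>)\<close>.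
  The boundary of \<open>K\<close> consists of \<open>\<alpha>\<close>, the left ends \<open>p j = frac (n j * \<alpha>)\<close> and the right ends
  \<open>\<beta> j\<close> of the intervals. All the \<open>p j\<close> lie on the orbit of \<open>\<alpha>\<close>, \<open>p j\<close> being reached at time
  \<open>n j - 1\<close>, whereas rational independence keeps the orbit of each \<open>\<beta> j\<close> away from every other boundary
  point (\<open>\<beta>_hit_unique\<close>). A point of \<open>Z\<close> over \<open>t\<close> is a limit of codings of points tending to \<open>t\<close>
  (\<open>Z_iff\<close>), so two points over \<open>t\<close> can differ only at times at which \<open>t\<close> meets the boundary: at most
  once if \<open>t\<close> is not on the orbit of \<open>\<alpha>\<close>. Over \<open>\<alpha>\<close> itself, approach from the left gives the symbol 0
  at all the times \<open>n j - 1\<close> and at time 0; approach from the right gives 1 at all the times \<open>n j - 1\<close>,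
  and at time 0 either symbol, because intervals of \<open>K\<close> and gaps alternate arbitrarily close to \<open>\<alpha>\<close>.
  Hence this fibre consists of the three special points (\<open>fibre_\<alpha>\<close>, \<open>z_minus_in_Z\<close>, \<open>plus_in_Z\<close>).

  Minimality: near every point of the circle there is an open arc on which any prescribed finite
  window of the coding is constant and equal to the window at that point (\<open>approach_settled\<close>), and
  each forward orbit of the rotation enters this arc.

  Li-Yorke pairs: \<open>Z\<close> is compact, so, whatever the metric, two points are close precisely when their
  circle coordinates are close and their symbols agree on a long window. A rotation
  preserves the difference of the circle coordinates, so a Li-Yorke pair lies in one fibre, and its
  symbols must differ at arbitrarily large times. This puts it over the orbit of \<open>\<alpha>\<close>; since
  \<open>z_plus1\<close> and \<open>z_plus0\<close> differ at time 0 only, the pair is a translate of one of the two listed pairs.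
  Those two differ exactly at the times \<open>n j - 1\<close>, with 0 added for \<open>z_plus1\<close>. The gaps between these
  times tend to infinity, because a bounded gap \<open>g\<close> occurring infinitely often would make
  \<open>g\<alpha>\<close> arbitrarily close to an integer (\<open>sparse_jump_times\<close>). Long gaps give \<open>liminf = 0\<close>, the
  infinitely many differences give \<open>limsup > 0\<close>. Recurrence would reproduce a fixed gap between two
  differences arbitrarily late, which growing gaps forbid; so no such pair is strong.
\<close>

section \<open>The circle, the full shift and their product\<close>

lemma topspace_full_shift [simp]: "topspace full_shift = UNIV"
  by (simp add: full_shift_def)

lemma openin_full_shift_coordinate: "openin full_shift {x. P (x i)}"
proof -
  have "continuous_map full_shift (discrete_topology UNIV) (\<lambda>x. x i)"
    unfolding full_shift_def by (rule continuous_map_product_projection) simp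
  then have "openin full_shift {x \<in> topspace full_shift. x i \<in> {b. P b}}"
    by (rule openin_continuous_map_preimage) simp
  then show ?thesis by simp
qed

lemma openin_full_shift_cylinder:
  "openin full_shift {y. \<forall>i. \<bar>i\<bar> \<le> int N \<longrightarrow> y i = x i}"
proof -
  have "openin full_shift (\<Inter>i\<in>{- int N..int N}. {y. y i = x i})"
    by (intro openin_Inter) (auto intro: openin_full_shift_coordinate)
  also have "(\<Inter>i\<in>{- int N..int N}. {y. y i = x i}) = {y. \<forall>i. \<bar>i\<bar> \<le> int N \<longrightarrow> y i = x i}"
    by (auto simp: abs_le_iff)
  finally show ?thesis .
qed

lemma openin_full_shift_cylinderE:
  assumes "openin full_shift W" "x \<in> W"
  obtains N where "\<And>y. (\<And>i. \<bar>i\<bar> \<le> int N \<Longrightarrow> y i = x i) \<Longrightarrow> y \<in> W"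
proof -
  obtain U where fin: "finite {i. U i \<noteq> UNIV}" and xU: "x \<in> Pi\<^sub>E UNIV U" and UW: "Pi\<^sub>E UNIV U \<subseteq> W"
    using assms unfolding full_shift_def openin_product_topology_alt by auto
  obtain N where N: "\<And>i. U i \<noteq> UNIV \<Longrightarrow> nat \<bar>i\<bar> \<le> N"
    using finite_nat_set_iff_bounded_le[THEN iffD1, OF finite_imageI[OF fin, of "\<lambda>i. nat \<bar>i\<bar>"]]
    by auto
  show ?thesis
  proof
    fix y assume y: "\<And>i. \<bar>i\<bar> \<le> int N \<Longrightarrow> y i = x i"
    have "y i \<in> U i" for i
    proof (cases "U i = UNIV")
      case False
      then have "y i = x i" using N[of i] y[of i] by (simp add: nat_le_iff)
      then show ?thesis using xU by auto
    qed auto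
    then show "y \<in> W" using UW by auto
  qed
qed

lemma openin_circle_arc: "openin circle {frac (t + h) | h. \<bar>h\<bar> < \<delta>}"
  unfolding openin_circle
proof
  show "{frac (t + h) | h. \<bar>h\<bar> < \<delta>} \<subseteq> {0..<1}"
    by (auto simp: frac_lt_1)
  have "frac -` {frac (t + h) | h. \<bar>h\<bar> < \<delta>} = (\<Union>k::int. ball (t + of_int k) \<delta>)"
  proof (intro set_eqI iffI)
    fix u assume "u \<in> frac -` {frac (t + h) | h. \<bar>h\<bar> < \<delta>}"
    then obtain h where h: "frac u = frac (t + h)" "\<bar>h\<bar> < \<delta>" by auto
    then obtain k where "u = t + h + of_int k" by (metis frac_eqE)
    then show "u \<in> (\<Union>k::int. ball (t + of_int k) \<delta>)"
      using h(2) by (auto simp: dist_real_def intro!: exI[of _ k])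
  next
    fix u assume "u \<in> (\<Union>k::int. ball (t + of_int k) \<delta>)"
    then obtain k :: int where "\<bar>u - t - of_int k\<bar> < \<delta>"
      by (auto simp: dist_real_def abs_minus_commute algebra_simps)
    moreover have "frac u = frac (t + (u - t - of_int k))"
      using frac_add_of_int_right[of "u - of_int k" k] by simp
    ultimately show "u \<in> frac -` {frac (t + h) | h. \<bar>h\<bar> < \<delta>}" by blast
  qed
  then show "open (frac -` {frac (t + h) | h. \<bar>h\<bar> < \<delta>})" by auto
qed

lemma openin_circle_arcE:
  assumes "openin circle V" "t \<in> V"
  obtains \<delta> where "\<delta> > 0" "\<And>h. \<bar>h\<bar> < \<delta> \<Longrightarrow> frac (t + h) \<in> V"
proof -
  have "t \<in> frac -` V" "open (frac -` V)"
    using assms by (auto simp: openin_circle subset_iff)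
  then obtain \<delta> where "\<delta> > 0" "ball t \<delta> \<subseteq> frac -` V"
    by (meson open_contains_ball)
  then show ?thesis
    by (intro that[of \<delta>]) (auto simp: subset_iff dist_real_def)
qed

text \<open>Closeness on the circle is expressed by a real displacement \<open>h\<close> rather than by a distance
  on \<open>{0..<1}\<close>, so that the identification of the two ends never has to be treated separately.\<close>
lemma closure_of_circle_shift_iff:
  "(t, x) \<in> prod_topology circle full_shift closure_of S \<longleftrightarrow>
     t \<in> {0..<1} \<and>
     (\<forall>\<delta>>0. \<forall>N::nat. \<exists>h y. \<bar>h\<bar> < \<delta> \<and> (frac (t + h), y) \<in> S \<and> (\<forall>i. \<bar>i\<bar> \<le> int N \<longrightarrow> y i = x i))"
  (is "?L \<longleftrightarrow> ?T \<and> ?R")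
proof
  assume L: ?L
  then have t: ?T by (auto simp: in_closure_of topspace_circle)
  moreover have ?R
  proof (intro allI impI)
    fix \<delta> :: real and N :: nat assume "\<delta> > 0"
    define U where "U = {frac (t + h) | h. \<bar>h\<bar> < \<delta>} \<times> {y. \<forall>i. \<bar>i\<bar> \<le> int N \<longrightarrow> y i = x i}"
    have "openin (prod_topology circle full_shift) U"
      unfolding U_def
      by (simp add: openin_prod_Times_iff openin_circle_arc openin_full_shift_cylinder)
    moreover have "(t, x) \<in> U"
      using t \<open>\<delta> > 0\<close> by (auto simp: U_def intro!: exI[of _ 0])
    ultimately obtain z where "z \<in> S" "z \<in> U"
      using L by (auto simp: in_closure_of)
    then show "\<exists>h y. \<bar>h\<bar> < \<delta> \<and> (frac (t + h), y) \<in> S \<and> (\<forall>i. \<bar>i\<bar> \<le> int N \<longrightarrow> y i = x i)"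
      by (auto simp: U_def)
  qed
  ultimately show "?T \<and> ?R" ..
next
  assume R: "?T \<and> ?R"
  show ?L
    unfolding in_closure_of
  proof (intro conjI allI impI)
    show "(t, x) \<in> topspace (prod_topology circle full_shift)"
      using R by (simp add: topspace_circle)
    fix U assume "(t, x) \<in> U \<and> openin (prod_topology circle full_shift) U"
    then obtain V W where VW: "openin circle V" "openin full_shift W" "t \<in> V" "x \<in> W" "V \<times> W \<subseteq> U"
      unfolding openin_prod_topology_alt by metis
    obtain \<delta> where "\<delta> > 0" and \<delta>: "\<And>h. \<bar>h\<bar> < \<delta> \<Longrightarrow> frac (t + h) \<in> V"
      using openin_circle_arcE VW by metis
    obtain N where N: "\<And>y. (\<And>i. \<bar>i\<bar> \<le> int N \<Longrightarrow> y i = x i) \<Longrightarrow> y \<in> W"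
      using openin_full_shift_cylinderE VW by metis
    obtain h y where "\<bar>h\<bar> < \<delta>" "(frac (t + h), y) \<in> S" "\<forall>i. \<bar>i\<bar> \<le> int N \<longrightarrow> y i = x i"
      using R \<open>\<delta> > 0\<close> by metis
    then show "\<exists>z. z \<in> S \<and> z \<in> U"
      using \<delta> N VW(5) by (intro exI[of _ "(frac (t + h), y)"]) auto
  qed
qed

lemma compact_space_circle: "compact_space circle"
proof -
  have "compactin euclidean {0..1::real}" by simp
  moreover have "continuous_map euclidean circle frac"
    using quotient_map_circle quotient_imp_continuous_map by blast
  ultimately have "compactin circle (frac ` {0..1})" by (rule image_compactin)
  moreover have "frac ` {0..1} = topspace circle"
    unfolding topspace_circle
  proof
    show "{0..<1} \<subseteq> frac ` {0..1::real}"
      by (metis atLeastAtMost_iff atLeastLessThan_iff frac_eq image_eqI less_imp_le subsetI)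
  qed (auto simp: frac_lt_1)
  ultimately show ?thesis by (simp add: compact_space_def)
qed

text \<open>The map \<open>t \<mapsto> exp(2\<pi>it)\<close> is continuous and injective into the complex plane.\<close>
lemma Hausdorff_circle: "Hausdorff_space circle"
proof (rule Hausdorff_space_injective_preimage)
  show "continuous_map circle euclidean (\<lambda>t. cis (2 * pi * t))"
  proof (rule continuous_compose_quotient_map[OF quotient_map_circle])
    have "cis (2 * pi * frac t) = cis (2 * pi * t)" for t :: real
    proof -
      have "cis (2 * pi * t) = cis (2 * pi * frac t) * cis (2 * pi * of_int \<lfloor>t\<rfloor>)"
        by (simp add: cis_mult frac_def algebra_simps)
      then show ?thesis by (simp add: cis_multiple_2pi)
    qed
    then have "(\<lambda>t. cis (2 * pi * t)) \<circ> frac = (\<lambda>t. cis (2 * pi * t))" by auto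
    then show "continuous_map euclidean euclidean ((\<lambda>t. cis (2 * pi * t)) \<circ> frac)"
      by (simp add: cis_conv_exp continuous_intros)
  qed
  show "inj_on (\<lambda>t. cis (2 * pi * t)) (topspace circle)"
  proof (rule inj_onI)
    fix s t :: real assume st: "s \<in> topspace circle" "t \<in> topspace circle"
      and "cis (2 * pi * s) = cis (2 * pi * t)"
    then have "cis (2 * pi * (s - t)) = 1"
      by (simp add: right_diff_distrib flip: cis_divide)
    then have "cos (2 * pi * (s - t)) = 1"
      by (metis cis.simps(1) one_complex.simps(1))
    then obtain k :: int where "2 * pi * (s - t) = of_int k * 2 * pi"
      using cos_one_2pi_int by auto
    then have "s - t = of_int k" by simp
    moreover have "\<bar>s - t\<bar> < 1" using st by (auto simp: topspace_circle)
    ultimately have "k = 0" by linarith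
    with \<open>s - t = of_int k\<close> show "s = t" by simp
  qed
qed (simp add: Hausdorff_space_euclidean)

lemma continuous_map_rotation: "continuous_map circle circle (rotation \<theta>)"
proof (rule continuous_compose_quotient_map[OF quotient_map_circle])
  have "rotation \<theta> \<circ> frac = frac \<circ> (\<lambda>t. t + \<theta>)"
    by (auto simp: rotation_def)
  moreover have "continuous_map euclidean circle (frac \<circ> (\<lambda>t. t + \<theta>))"
    using quotient_map_circle quotient_imp_continuous_map
    by (intro continuous_map_compose[of _ euclidean]) (auto intro!: continuous_intros)
  ultimately show "continuous_map euclidean circle (rotation \<theta> \<circ> frac)" by simp
qed

lemma compact_space_full_shift: "compact_space full_shift"
  by (simp add: full_shift_def compact_space_product_topology compact_space_discrete_topology)

section \<open>Compactness of the system and compatible metrics\<close>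

lemma topspace_Z_top [simp]: "topspace (Z_top \<alpha> n \<beta>) = Z_set \<alpha> n \<beta>"
  by (auto simp: Z_top_def Z_set_def in_closure_of)

lemma compact_space_Z_top: "compact_space (Z_top \<alpha> n \<beta>)"
  unfolding Z_top_def
  by (intro compact_space_subtopology closedin_compact_space)
     (auto simp: Z_set_def compact_space_prod_topology compact_space_circle compact_space_full_shift)

lemma continuous_map_Z_fst: "continuous_map (Z_top \<alpha> n \<beta>) circle fst"
  unfolding Z_top_def by (intro continuous_map_from_subtopology continuous_map_fst)

lemma continuous_map_Z_snd: "continuous_map (Z_top \<alpha> n \<beta>) full_shift snd"
  unfolding Z_top_def by (intro continuous_map_from_subtopology continuous_map_snd)

lemma continuous_map_Z_coordinate:
  "continuous_map (Z_top \<alpha> n \<beta>) (discrete_topology UNIV) (\<lambda>z. snd z i)"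
proof -
  have "continuous_map full_shift (discrete_topology UNIV) (\<lambda>x. x i)"
    unfolding full_shift_def by (rule continuous_map_product_projection) simp
  from continuous_map_compose[OF continuous_map_Z_snd this] show ?thesis
    by (simp add: o_def)
qed

lemma compact_positive_lower_bound:
  assumes "compactin X C" "continuous_map X euclideanreal f" "\<And>x. x \<in> C \<Longrightarrow> f x > 0"
  obtains \<epsilon> where "\<epsilon> > 0" "\<And>x. x \<in> C \<Longrightarrow> f x \<ge> \<epsilon>"
proof (cases "C = {}")
  case False
  have "compact (f ` C)"
    using image_compactin[OF assms(1,2)] by simp
  then obtain s where "s \<in> f ` C" "\<And>t. t \<in> f ` C \<Longrightarrow> s \<le> t"
    using compact_attains_inf[of "f ` C"] False by auto
  then show ?thesis
    using that[of s] assms(3) by auto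
qed (use that[of 1] in auto)

locale compact_metrized =
  fixes X :: "'a topology" and \<rho> :: "'a \<Rightarrow> 'a \<Rightarrow> real"
  assumes compact: "compact_space X" and compatible: "compatible_metric X \<rho>"
begin

lemma metric: "Metric_space (topspace X) \<rho>"
  using compatible by (simp add: compatible_metric_def)

lemma continuous_metric: "continuous_map (prod_topology X X) euclideanreal (\<lambda>z. \<rho> (fst z) (snd z))"
proof -
  interpret Metric_space "topspace X" \<rho> by (rule metric)
  have "mtopology_of (metric (topspace X, \<rho>)) = X"
    using compatible by (simp add: compatible_metric_def mtopology_of_def)
  then have "continuous_map (prod_topology X X) euclidean
      (\<lambda>z. mdist (metric (topspace X, \<rho>)) (fst z) (snd z))"
    by (intro continuous_map_mdist) (auto simp: continuous_map_fst continuous_map_snd)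
  then show ?thesis by simp
qed

lemma compact_prod: "compact_space (prod_topology X X)"
  using compact by (simp add: compact_space_prod_topology)

text \<open>The two lemmas below replace uniform continuity: they compare an arbitrary compatible metric with
  closed conditions on pairs of points.\<close>
lemma separated_from_diagonal:
  assumes "closedin (prod_topology X X) C" "\<And>z. (z, z) \<notin> C"
  obtains \<epsilon> where "\<epsilon> > 0" "\<And>z w. (z, w) \<in> C \<Longrightarrow> \<rho> z w \<ge> \<epsilon>"
proof -
  have sub: "C \<subseteq> topspace X \<times> topspace X"
    using closedin_subset[OF assms(1)] by simp
  have "\<rho> (fst z) (snd z) > 0" if "z \<in> C" for z
  proof -
    have "fst z \<noteq> snd z" using assms(2)[of "fst z"] that by (metis prod.collapse)
    then show ?thesis
      using Metric_space.mdist_pos_less[OF metric] that sub by auto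
  qed
  then obtain \<epsilon> where "\<epsilon> > 0" "\<And>z. z \<in> C \<Longrightarrow> \<epsilon> \<le> \<rho> (fst z) (snd z)"
    using compact_positive_lower_bound[OF closedin_compact_space[OF compact_prod assms(1)]
        continuous_metric] by blast
  then show ?thesis using that by force
qed

text \<open>The closed sets of pairs in \<open>C N\<close> at distance at least \<open>\<epsilon>\<close> decrease and have empty intersection,
  so one of them is empty.\<close>
lemma small_near_diagonal:
  assumes clo: "\<And>N::nat. closedin (prod_topology X X) (C N)" and "decseq C"
    and diag: "\<And>z w. (\<And>N. (z, w) \<in> C N) \<Longrightarrow> z = w" and "\<epsilon> > 0"
  obtains N where "\<And>z w. (z, w) \<in> C N \<Longrightarrow> \<rho> z w < \<epsilon>"
proof -
  define B where "B N = C N \<inter> {z \<in> topspace (prod_topology X X). \<rho> (fst z) (snd z) \<in> {\<epsilon>..}}" for N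
  have "closedin (prod_topology X X) (B N)" for N
    unfolding B_def
    by (intro closedin_Int clo closedin_continuous_map_preimage[OF continuous_metric]) simp
  moreover have "decseq B"
    using \<open>decseq C\<close> unfolding B_def decseq_def by blast
  moreover have "(\<Inter>N. B N) = {}"
  proof -
    have False if "\<And>N. (z, w) \<in> B N" for z w
    proof -
      have "z = w" using that diag by (simp add: B_def)
      moreover have "z \<in> topspace X" "\<rho> z w \<ge> \<epsilon>" using that[of 0] by (auto simp: B_def)
      ultimately show False
        using Metric_space.mdist_zero[OF metric] \<open>\<epsilon> > 0\<close> by auto
    qed
    then show ?thesis by auto
  qed
  ultimately obtain N where "B N = {}"
    using compact_space_imp_nest[OF compact_prod, of B] by auto
  then have "\<rho> z w < \<epsilon>" if "(z, w) \<in> C N" for z w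
    using that closedin_subset[OF clo[of N]] by (force simp: B_def)
  then show ?thesis using that by blast
qed

end

section \<open>Integer flows, rational spans and sparse sets of times\<close>

lemma frac_frac_add: "a + b = c \<Longrightarrow> frac (frac a + b) = frac c"
  for a b c :: real
  by auto

text \<open>Integer iterates are defined through \<open>inv_into\<close>; an explicit two-sided flow avoids computing
  inverses, for the rotation as well as for \<open>F\<close>.\<close>
lemma int_iter_eq_flow:
  assumes maps: "\<And>i x. x \<in> X \<Longrightarrow> \<Phi> i x \<in> X" and zero: "\<And>x. x \<in> X \<Longrightarrow> \<Phi> 0 x = x"
    and step: "\<And>i x. x \<in> X \<Longrightarrow> \<Phi> (i + 1) x = f (\<Phi> i x)" and inj: "inj_on f X" and x: "x \<in> X"
  shows "int_iter X f i x = \<Phi> i x"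
proof -
  have pos: "(f ^^ m) x = \<Phi> (int m) x" for m
  proof (induction m)
    case (Suc m)
    then show ?case using step[OF x, of "int m"] by (simp add: add.commute)
  qed (simp add: zero[OF x])
  have neg: "(inv_into X f ^^ m) x = \<Phi> (- int m) x" for m
  proof (induction m)
    case (Suc m)
    have "f (\<Phi> (- int (Suc m)) x) = \<Phi> (- int m) x"
      using step[OF x, of "- int (Suc m)"] by simp
    then have "inv_into X f (\<Phi> (- int m) x) = \<Phi> (- int (Suc m)) x"
      by (intro inv_into_f_eq[OF inj] maps x) 
    then show ?case using Suc by simp
  qed (simp add: zero[OF x])
  show ?thesis
  proof (cases "0 \<le> i")
    case True
    then show ?thesis using pos[of "nat i"] by (simp add: int_iter_def)
  next
    case False
    then show ?thesis using neg[of "nat (- i)"] by (simp add: int_iter_def)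
  qed
qed

interpretation rational: module "\<lambda>(q::rat) (x::real). of_rat q * x"
  by unfold_locales (auto simp: algebra_simps of_rat_add of_rat_mult)

lemma rat_span_base: "x \<in> S \<Longrightarrow> x \<in> rat_span S"
  by (simp add: rat_span_def rational.span_base)

lemma rat_span_add: "x \<in> rat_span S \<Longrightarrow> y \<in> rat_span S \<Longrightarrow> x + y \<in> rat_span S"
  by (simp add: rat_span_def rational.span_add)

lemma rat_span_int_mult: "x \<in> rat_span S \<Longrightarrow> of_int k * x \<in> rat_span S"
  using rational.span_scale[of x S "of_int k"] by (simp add: rat_span_def)

lemma eventually_nhds_shift:
  fixes u :: real
  assumes "eventually P (nhds u)"
  shows "\<forall>\<^sub>F h in nhds 0. P (u + h)"
proof -
  obtain d where "d > 0" "\<And>w. dist w u < d \<Longrightarrow> P w"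
    using assms by (auto simp: eventually_nhds_metric)
  then show ?thesis
    by (auto simp: eventually_nhds_metric dist_real_def intro!: exI[of _ d])
qed

text \<open>The gaps to the right of \<open>i\<close> tend to infinity as \<open>i\<close> grows; finite sets are included.\<close>
definition sparse :: "int set \<Rightarrow> bool" where
  "sparse D \<longleftrightarrow> (\<forall>L. \<exists>M. \<forall>i\<in>D. \<forall>j\<in>D. M \<le> i \<and> i < j \<longrightarrow> L < j - i)"

lemma sparse_insert: "sparse D \<Longrightarrow> sparse (insert a D)"
  unfolding sparse_def
proof
  fix L assume "\<forall>L. \<exists>M. \<forall>i\<in>D. \<forall>j\<in>D. M \<le> i \<and> i < j \<longrightarrow> L < j - i"
  then obtain M where M: "\<And>i j. i \<in> D \<Longrightarrow> j \<in> D \<Longrightarrow> M \<le> i \<Longrightarrow> i < j \<Longrightarrow> L < j - i" by metis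
  show "\<exists>M. \<forall>i\<in>insert a D. \<forall>j\<in>insert a D. M \<le> i \<and> i < j \<longrightarrow> L < j - i"
    by (rule exI[of _ "max M (a + 1)"]) (auto intro: M)
qed

lemma sparse_shift:
  assumes "sparse D" shows "sparse {i. i + k \<in> D}"
  unfolding sparse_def
proof
  fix L
  obtain M where M: "\<And>i j. i \<in> D \<Longrightarrow> j \<in> D \<Longrightarrow> M \<le> i \<Longrightarrow> i < j \<Longrightarrow> L < j - i"
    using assms unfolding sparse_def by metis
  show "\<exists>M. \<forall>i\<in>{i. i + k \<in> D}. \<forall>j\<in>{i. i + k \<in> D}. M \<le> i \<and> i < j \<longrightarrow> L < j - i"
    by (rule exI[of _ "M - k"]) (use M[of "_ + k" "_ + k"] in auto)
qed

text \<open>In an unbounded sparse set the gap after a late element has room for a window of any size.\<close>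
lemma sparse_gap:
  assumes "sparse D" and unb: "\<And>M. \<exists>i\<in>D. M \<le> i"
  obtains m where "M \<le> m" "\<And>i. \<bar>i\<bar> \<le> int N \<Longrightarrow> m + i \<notin> D"
proof -
  obtain M' where M': "\<And>i j. i \<in> D \<Longrightarrow> j \<in> D \<Longrightarrow> M' \<le> i \<Longrightarrow> i < j \<Longrightarrow> 2 * int N + 2 < j - i"
    using assms(1) unfolding sparse_def by metis
  obtain i0 where i0: "i0 \<in> D" "max M M' \<le> i0" using unb by blast
  show ?thesis
  proof (rule that)
    show "M \<le> i0 + int N + 1" using i0 by simp
    fix i assume i: "\<bar>i\<bar> \<le> int N"
    show "i0 + int N + 1 + i \<notin> D"
    proof
      assume "i0 + int N + 1 + i \<in> D"
      then have "2 * int N + 2 < i0 + int N + 1 + i - i0"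
        using i i0 by (intro M') auto
      then show False using i by auto
    qed
  qed
qed

section \<open>Local behaviour of the coding\<close>

locale interval_coding =
  fixes \<alpha> :: real and n :: "nat \<Rightarrow> nat" and \<beta> :: "nat \<Rightarrow> real"
  assumes \<alpha>_nonneg: "0 \<le> \<alpha>" and \<alpha>_less: "\<alpha> < 1" and \<alpha>_irrational: "\<alpha> \<notin> \<rat>"
    and n_0: "n 0 = 1"
    and n_mono: "strict_mono_on {1..} n"
    and frac_antimono: "strict_antimono_on {1..} (\<lambda>j. frac (real (n j) * \<alpha>))"
    and frac_tendsto: "(\<lambda>j. frac (real (n j) * \<alpha>)) \<longlonglongrightarrow> \<alpha>"
    and \<beta>_1: "frac (real (n 1) * \<alpha>) < \<beta> 1" "\<beta> 1 < 1"
    and \<beta>_between: "\<forall>j>1. frac (real (n j) * \<alpha>) < \<beta> j \<and> \<beta> j < frac (real (n (j - 1)) * \<alpha>)"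
    and \<beta>_independent: "\<forall>j\<ge>1. \<beta> j \<notin> rat_span ({1, \<alpha>} \<union> \<beta> ` {1..<j})"
begin

definition p :: "nat \<Rightarrow> real" where "p j = frac (real (n j) * \<alpha>)"

definition visits :: "real \<Rightarrow> bool" where "visits u \<longleftrightarrow> frac u \<in> K_set \<alpha> n \<beta>"

text \<open>For \<open>settled b u\<close> the value must be attained at \<open>u\<close> too, as the full neighbourhood filter is used;
  the condition is open in \<open>u\<close>, which makes it possible to collect finitely many one-sided statements
  by filter arguments.\<close>
definition settled :: "bool \<Rightarrow> real \<Rightarrow> bool" where
  "settled b u \<longleftrightarrow> (\<forall>\<^sub>F w in nhds u. visits w = b)"

definition jump :: "real \<Rightarrow> bool" where
  "jump u \<longleftrightarrow> frac u = \<alpha> \<or> (\<exists>j\<ge>1. frac u = p j \<or> frac u = \<beta> j)"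

lemma \<alpha>_pos: "0 < \<alpha>"
  using \<alpha>_nonneg \<alpha>_irrational by (cases "\<alpha> = 0") auto

lemma p_less: "p j < 1" by (simp add: p_def frac_lt_1)

lemma p_antimono: "1 \<le> i \<Longrightarrow> i < j \<Longrightarrow> p j < p i"
  using frac_antimono by (simp add: p_def monotone_on_def)

lemma p_tendsto: "p \<longlonglongrightarrow> \<alpha>" using frac_tendsto by (simp add: p_def[abs_def])

lemma \<alpha>_less_p: assumes "1 \<le> j" shows "\<alpha> < p j"
proof -
  have "\<alpha> \<le> p (Suc j)"
    using p_antimono assms
    by (intro LIMSEQ_le_const2[OF p_tendsto] exI[of _ "Suc j"])
       (metis Suc_eq_plus1 le_add2 le_neq_implies_less less_imp_le order_refl)
  also have "\<dots> < p j" using p_antimono assms by simp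
  finally show ?thesis .
qed

lemma p_less_\<beta>: "1 \<le> j \<Longrightarrow> p j < \<beta> j"
  using \<beta>_between \<beta>_1 by (cases "j = 1") (auto simp: p_def)

lemma \<beta>_less_p: assumes "1 \<le> i" "i < j" shows "\<beta> j < p i"
proof -
  have "\<beta> j < p (j - 1)" using \<beta>_between assms by (simp add: p_def)
  also have "p (j - 1) \<le> p i"
    using p_antimono[of i "j - 1"] assms by (cases "i = j - 1") (simp, linarith)
  finally show ?thesis .
qed

lemma K_iff: "v \<in> K_set \<alpha> n \<beta> \<longleftrightarrow> v = \<alpha> \<or> (\<exists>j\<ge>1. p j \<le> v \<and> v \<le> \<beta> j)"
  by (auto simp: K_set_def p_def)

lemma below_notin_K: "v < \<alpha> \<Longrightarrow> v \<notin> K_set \<alpha> n \<beta>"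
  using \<alpha>_less_p by (force simp: K_iff)

lemma gap_notin_K:
  assumes j: "1 \<le> j" and v: "\<beta> j < v" "j = 1 \<or> v < p (j - 1)"
  shows "v \<notin> K_set \<alpha> n \<beta>"
proof
  assume "v \<in> K_set \<alpha> n \<beta>"
  moreover have "v \<noteq> \<alpha>" using v \<alpha>_less_p[OF j] p_less_\<beta>[OF j] by simp
  ultimately obtain k where k: "1 \<le> k" "p k \<le> v" "v \<le> \<beta> k" by (auto simp: K_iff)
  have "k < j"
    using \<beta>_less_p[OF j, of k] p_less_\<beta>[OF j] k v by (cases k j rule: linorder_cases) auto
  then have "1 < j" "k \<le> j - 1" using k by auto
  then have "p (j - 1) \<le> p k" using p_antimono[of k "j - 1"] k by (cases "k = j - 1") auto
  then show False using v k \<open>1 < j\<close> by auto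
qed

text \<open>For \<open>v > \<alpha>\<close> the least \<open>j\<close> with \<open>p j \<le> v\<close> locates \<open>v\<close> in the \<open>j\<close>-th interval or in the gap to its right.
  Closedness of \<open>K\<close> thus never has to be argued globally.\<close>
lemma position_cases:
  obtains (below) "v < \<alpha>" | (alpha) "v = \<alpha>"
  | (inside) j where "1 \<le> j" "p j \<le> v" "v \<le> \<beta> j"
  | (gap) j where "1 \<le> j" "\<beta> j < v" "j = 1 \<or> v < p (j - 1)"
proof (cases "\<alpha> < v")
  case True
  have "\<forall>\<^sub>F j in sequentially. 1 \<le> j \<and> p j < v"
    using order_tendstoD(2)[OF p_tendsto True] eventually_ge_at_top[of 1] by eventually_elim auto
  then have ex: "\<exists>j. 1 \<le> j \<and> p j < v" using eventually_happens'[OF sequentially_bot] by blast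
  define j where "j = (LEAST j. 1 \<le> j \<and> p j \<le> v)"
  have j: "1 \<le> j" "p j \<le> v"
    unfolding j_def using LeastI_ex[of "\<lambda>j. 1 \<le> j \<and> p j \<le> v"] ex less_imp_le by blast+
  have "j = 1 \<or> v < p (j - 1)"
  proof (rule ccontr)
    assume "\<not> (j = 1 \<or> v < p (j - 1))"
    then have "1 \<le> j - 1 \<and> p (j - 1) \<le> v" using j by auto
    then have "j \<le> j - 1" unfolding j_def by (rule Least_le)
    then show False using j by simp
  qed
  then show ?thesis using inside gap j by (cases "v \<le> \<beta> j") auto
qed (use below alpha in fastforce)

lemma settled_visits: "settled b u \<Longrightarrow> visits u = b"
  unfolding settled_def by (drule eventually_nhds_x_imp_x)

lemma settled_eventually: "settled b u \<Longrightarrow> \<forall>\<^sub>F h in nhds 0. settled b (u + h)"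
  unfolding settled_def
  by (rule eventually_nhds_shift) (simp add: eventually_eventually)

lemma visits_cong: "frac u = frac w \<Longrightarrow> visits u = visits w"
  by (simp add: visits_def)

lemma settled_cong:
  assumes "frac u = frac w" "settled b w" shows "settled b u"
proof -
  obtain k where k: "u = w + of_int k" using assms(1) by (rule frac_eqE)
  obtain d where "d > 0" and d: "\<And>v. dist v w < d \<Longrightarrow> visits v = b"
    using assms(2) by (auto simp: settled_def eventually_nhds_metric)
  have "visits v = b" if "dist v u < d" for v
  proof -
    have "dist (v - of_int k) w < d" using that by (simp add: k dist_real_def algebra_simps)
    moreover have "visits (v - of_int k) = visits v"
      using frac_add_of_int_right[of "v - of_int k" k] by (intro visits_cong) simp
    ultimately show ?thesis using d by blast
  qed
  then show ?thesis using \<open>d > 0\<close> by (auto simp: settled_def eventually_nhds_metric)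
qed

lemma settled_interval:
  assumes "0 \<le> a" "a < frac u" "frac u < b" and K: "\<And>v. a < v \<Longrightarrow> v < b \<Longrightarrow> v < 1 \<Longrightarrow> v \<in> K_set \<alpha> n \<beta> \<longleftrightarrow> P"
  shows "settled P u"
proof -
  have "((\<lambda>w. frac u + (w - u)) \<longlongrightarrow> frac u + (u - u)) (nhds u)"
    by (intro tendsto_intros filterlim_ident)
  then have "\<forall>\<^sub>F w in nhds u. a < frac u + (w - u) \<and> frac u + (w - u) < min b 1"
    using assms frac_lt_1[of u]
    by (simp only: diff_self add_0_right eventually_conj_iff order_tendstoD min_less_iff_conj)
  then show ?thesis
    unfolding settled_def
  proof eventually_elim
    case (elim w)
    then have "frac w = frac u + (w - u)"
      using \<open>0 \<le> a\<close> frac_add_simps(1)[of u "w - u"] frac_eq_id[of "frac u + (w - u)"] by auto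
    then show ?case using elim K by (simp add: visits_def)
  qed
qed

lemma settled_right:
  assumes "frac u < b" and "\<And>v. frac u < v \<Longrightarrow> v < b \<Longrightarrow> v < 1 \<Longrightarrow> v \<in> K_set \<alpha> n \<beta> \<longleftrightarrow> P"
  shows "\<forall>\<^sub>F h in at_right 0. settled P (u + h)"
  unfolding eventually_at_right_field
proof (intro exI[of _ "min b 1 - frac u"] conjI allI impI)
  show "0 < min b 1 - frac u" using assms frac_lt_1[of u] by simp
  fix h assume h: "0 < h" "h < min b 1 - frac u"
  then have "frac (u + h) = frac u + h"
    using frac_add_simps(1)[of u h] frac_eq_id[of "frac u + h"] by auto
  then show "settled P (u + h)" using h assms(2) by (intro settled_interval[of "frac u" _ b]) auto
qed

lemma settled_left:
  assumes "0 \<le> a" "a < frac u" and "\<And>v. a < v \<Longrightarrow> v < frac u \<Longrightarrow> v \<in> K_set \<alpha> n \<beta> \<longleftrightarrow> P"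
  shows "\<forall>\<^sub>F h in at_left 0. settled P (u + h)"
  unfolding eventually_at_left_field
proof (intro exI[of _ "a - frac u"] conjI allI impI)
  show "a - frac u < 0" using assms by simp
  fix h assume h: "a - frac u < h" "h < 0"
  then have "frac (u + h) = frac u + h"
    using frac_add_simps(1)[of u h] frac_eq_id[of "frac u + h"] frac_lt_1[of u] \<open>0 \<le> a\<close> by auto
  then show "settled P (u + h)"
    using h assms by (intro settled_interval[of a _ "frac u"]) auto
qed

text \<open>The point 0 is treated apart, since only there the representatives in \<open>{0..<1}\<close> of nearby points
  jump; \<open>K\<close> stays away from both ends.\<close>
lemma settled_if_not_jump:
  assumes "\<not> jump u" shows "settled (visits u) u"
proof -
  let ?v = "frac u"
  have pos: "0 \<le> p j" for j by (simp add: p_def)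
  have "\<exists>P. settled P u"
  proof (cases "?v = 0")
    case True
    have "\<forall>\<^sub>F w in nhds u. \<bar>w - u\<bar> < min \<alpha> (1 - \<beta> 1)"
      using \<alpha>_pos \<beta>_1 by (auto simp: eventually_nhds_metric dist_real_def intro!: exI[of _ "min \<alpha> (1 - \<beta> 1)"])
    then have "settled False u"
      unfolding settled_def
    proof eventually_elim
      case (elim w)
      have w: "frac w = frac (w - u)"
        using frac_add_simps(1)[of u "w - u"] True by simp
      show ?case
      proof (cases "w - u < 0")
        case True
        then have "frac (w - u) = w - u + 1"
          using elim \<alpha>_less frac_1_eq[of "w - u"] frac_eq_id[of "w - u + 1"] by auto
        then have "\<beta> 1 < frac w" using elim w by auto
        then show ?thesis using gap_notin_K[of 1] by (simp add: visits_def)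
      next
        case False
        then have "frac w < \<alpha>" using elim w \<alpha>_less frac_eq_id[of "w - u"] by auto
        then show ?thesis using below_notin_K by (simp add: visits_def)
      qed
    qed
    then show ?thesis ..
  next
    case False
    then have v: "0 < ?v" by (metis frac_ge_0 order_le_less)
    show ?thesis
    proof (cases rule: position_cases[of ?v])
      case below
      then have "settled False u"
        using v below_notin_K by (intro settled_interval[of 0 _ \<alpha>]) auto
      then show ?thesis ..
    next
      case alpha
      then show ?thesis using assms by (simp add: jump_def)
    next
      case (inside j)
      then have "p j < ?v" "?v < \<beta> j" using assms by (auto simp: jump_def order_le_less)
      then have "settled True u"
        using inside(1) by (intro settled_interval[of "p j" _ "\<beta> j"] pos) (auto simp: K_iff)
      then show ?thesis ..
    next
      case (gap j)
      have "settled False u"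
      proof (rule settled_interval[of "\<beta> j" _ "if j = 1 then 1 else p (j - 1)"])
        show "0 \<le> \<beta> j" using pos[of j] p_less_\<beta>[OF gap(1)] by simp
      qed (use gap gap_notin_K frac_lt_1[of u] in \<open>auto split: if_splits\<close>)
      then show ?thesis ..
    qed
  qed
  then show ?thesis using settled_visits by auto
qed

lemma p_right: "1 \<le> j \<Longrightarrow> frac u = p j \<Longrightarrow> \<forall>\<^sub>F h in at_right 0. settled True (u + h)"
  using p_less_\<beta> by (intro settled_right[of _ "\<beta> j"]) (auto simp: K_iff intro: less_imp_le)

lemma p_left:
  assumes "1 \<le> j" "frac u = p j" shows "\<forall>\<^sub>F h in at_left 0. settled False (u + h)"
proof (rule settled_left)
  show "0 \<le> \<beta> (Suc j)" using p_less_\<beta>[of "Suc j"] \<alpha>_less_p[of "Suc j"] \<alpha>_pos by simp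
qed (use assms \<beta>_less_p gap_notin_K[of "Suc j"] in auto)

lemma \<beta>_left:
  assumes "1 \<le> j" "frac u = \<beta> j" shows "\<forall>\<^sub>F h in at_left 0. settled True (u + h)"
proof (rule settled_left)
  show "0 \<le> p j" by (simp add: p_def)
qed (use assms p_less_\<beta> in \<open>auto simp: K_iff intro: less_imp_le\<close>)

lemma \<alpha>_left: "frac u = \<alpha> \<Longrightarrow> \<forall>\<^sub>F h in at_left 0. settled False (u + h)"
  using \<alpha>_pos below_notin_K by (intro settled_left[of 0]) auto

text \<open>Intervals and gaps both accumulate at \<open>\<alpha>\<close> from the right; this is why the fibre over \<open>\<alpha>\<close>
  has three points and not two.\<close>
lemma \<alpha>_right:
  assumes u: "frac u = \<alpha>"
  shows "\<exists>\<^sub>F h in at_right 0. settled b (u + h)"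
  unfolding frequently_def
proof
  assume "\<forall>\<^sub>F h in at_right 0. \<not> settled b (u + h)"
  then obtain d where "d > 0" and d: "\<And>h. 0 < h \<Longrightarrow> h < d \<Longrightarrow> \<not> settled b (u + h)"
    unfolding eventually_at_right_field by blast
  have "\<forall>\<^sub>F j in sequentially. 1 \<le> j \<and> p j < \<alpha> + d"
    using order_tendstoD(2)[OF p_tendsto, of "\<alpha> + d"] eventually_ge_at_top[of 1] \<open>d > 0\<close>
    by (simp add: eventually_conj_iff)
  then obtain j where j: "1 \<le> j" "p j < \<alpha> + d"
    using eventually_happens'[OF sequentially_bot] by blast
  have order: "\<alpha> < p (Suc j)" "p (Suc j) < \<beta> (Suc j)" "\<beta> (Suc j) < p j" "p j < 1"
    using \<alpha>_less_p p_less_\<beta> \<beta>_less_p p_less j by auto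
  \<comment> \<open>The end points of an interval of \<open>K\<close> or of the gap following it, within \<open>d\<close> of \<open>\<alpha>\<close>.\<close>
  define l r where "l = (if b then p (Suc j) else \<beta> (Suc j))"
    and "r = (if b then \<beta> (Suc j) else p j)"
  have lr: "\<alpha> < l" "l < r" "r < 1" "r < \<alpha> + d"
    using order j by (auto simp: l_def r_def)
  define h where "h = (l + r) / 2 - \<alpha>"
  have h: "0 < h" "h < d" "l < \<alpha> + h" "\<alpha> + h < r" using lr by (auto simp: h_def field_simps)
  have fr: "frac (u + h) = \<alpha> + h"
    using h lr \<alpha>_pos frac_add_simps(1)[of u h] frac_eq_id[of "\<alpha> + h"] u by auto
  have "settled b (u + h)"
  proof (rule settled_interval[of l _ r])
    fix v assume v: "l < v" "v < r"
    show "v \<in> K_set \<alpha> n \<beta> \<longleftrightarrow> b"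
    proof (cases b)
      case True
      then show ?thesis using v by (auto simp: K_iff l_def r_def intro!: exI[of _ "Suc j"])
    next
      case False
      then show ?thesis using v gap_notin_K[of "Suc j" v] by (auto simp: l_def r_def)
    qed
  qed (use h lr fr \<alpha>_pos in auto)
  then show False using d h by blast
qed

section \<open>Times at which an orbit meets the boundary\<close>

lemma visits_\<alpha>: "frac u = \<alpha> \<Longrightarrow> visits u" by (simp add: visits_def K_iff)
lemma visits_p: "1 \<le> j \<Longrightarrow> frac u = p j \<Longrightarrow> visits u"
  using p_less_\<beta> by (auto simp: visits_def K_iff intro: less_imp_le)
lemma visits_\<beta>: "1 \<le> j \<Longrightarrow> frac u = \<beta> j \<Longrightarrow> visits u"
  using p_less_\<beta> by (auto simp: visits_def K_iff intro: less_imp_le)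

lemma int_multiple_eq:
  assumes "of_int a * \<alpha> = of_int b" shows "a = 0"
proof (rule ccontr)
  assume "a \<noteq> 0"
  then have "\<alpha> = of_int b / of_int a" using assms by (simp add: field_simps)
  then show False using \<alpha>_irrational by auto
qed

lemma rat_span_int_comb:
  assumes "{1, \<alpha>} \<subseteq> S" shows "of_int a + of_int b * \<alpha> \<in> rat_span S"
  using rat_span_add[OF rat_span_int_mult[OF rat_span_base, of 1 S a]
      rat_span_int_mult[OF rat_span_base, of \<alpha> S b]] assms by auto

lemma \<beta>_notin_int_comb: "1 \<le> j \<Longrightarrow> \<beta> j \<noteq> of_int a + of_int b * \<alpha>"
  using \<beta>_independent rat_span_int_comb[of "{1, \<alpha>} \<union> \<beta> ` {1..<j}" a b] by auto

lemma \<beta>_diff_ne: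
  assumes "1 \<le> k" "k < j" shows "\<beta> j \<noteq> \<beta> k + (of_int a + of_int b * \<alpha>)"
proof -
  have "\<beta> k \<in> rat_span ({1, \<alpha>} \<union> \<beta> ` {1..<j})" using assms by (intro rat_span_base) auto
  then have "\<beta> k + (of_int a + of_int b * \<alpha>) \<in> rat_span ({1, \<alpha>} \<union> \<beta> ` {1..<j})"
    by (intro rat_span_add rat_span_int_comb) auto
  moreover have "\<beta> j \<notin> rat_span ({1, \<alpha>} \<union> \<beta> ` {1..<j})" using \<beta>_independent assms by auto
  ultimately show ?thesis by metis
qed

lemma frac_eq_orbit: 
  fixes t :: real
  obtains a where "frac (t + of_int i * \<alpha>) = frac (t + of_int i' * \<alpha>) + (of_int a + of_int (i - i') * \<alpha>)"
  by (rule that[of "\<lfloor>t + of_int i' * \<alpha>\<rfloor> - \<lfloor>t + of_int i * \<alpha>\<rfloor>"])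
     (simp add: frac_def algebra_simps)

text \<open>Two visits to the boundary by one orbit, the first at \<open>\<beta> j\<close>, would express \<open>\<beta> j\<close>, or the later
  of two \<open>\<beta>\<close>'s, as a rational combination of 1, \<open>\<alpha>\<close> and earlier \<open>\<beta>\<close>'s; if the two boundary points
  coincide, irrationality of \<open>\<alpha>\<close> makes the times coincide.\<close>
lemma \<beta>_hit_unique:
  assumes j: "1 \<le> j" and i: "frac (t + of_int i * \<alpha>) = \<beta> j" and jump: "jump (t + of_int i' * \<alpha>)"
  shows "i = i'"
proof -
  obtain a where a: "\<beta> j = frac (t + of_int i' * \<alpha>) + (of_int a + of_int (i - i') * \<alpha>)"
    using frac_eq_orbit[of t i i'] i by metis
  have "frac (t + of_int i' * \<alpha>) \<noteq> \<alpha>"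
    using a \<beta>_notin_int_comb[OF j, of a "i - i' + 1"] by (auto simp: algebra_simps)
  moreover have "frac (t + of_int i' * \<alpha>) \<noteq> p k" for k
    using a \<beta>_notin_int_comb[OF j, of "a - \<lfloor>real (n k) * \<alpha>\<rfloor>" "i - i' + int (n k)"]
    by (auto simp: algebra_simps p_def frac_def)
  ultimately obtain k where k: "1 \<le> k" "frac (t + of_int i' * \<alpha>) = \<beta> k"
    using jump by (auto simp: jump_def)
  have "\<not> k < j" using a k \<beta>_diff_ne by metis
  moreover have "\<not> j < k"
    using a k \<beta>_diff_ne[OF j, of k "- a" "i' - i"] by (auto simp: algebra_simps)
  ultimately have "k = j" by simp
  then have "of_int (i - i') * \<alpha> = of_int (- a)" using a k by simp
  then have "i - i' = 0" by (rule int_multiple_eq)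
  then show ?thesis by simp
qed

lemma two_jumps_orbit:
  assumes "i \<noteq> i'" "jump (t + of_int i * \<alpha>)" "jump (t + of_int i' * \<alpha>)"
  obtains k :: int where "frac t = frac (\<alpha> + of_int k * \<alpha>)"
proof -
  have "\<exists>m::int. frac (t + of_int i * \<alpha>) = frac (of_int m * \<alpha>)"
  proof -
    consider "frac (t + of_int i * \<alpha>) = \<alpha>" | j where "frac (t + of_int i * \<alpha>) = p j"
      using assms \<beta>_hit_unique unfolding jump_def by blast
    then show ?thesis
    proof cases
      case 1
      then show ?thesis using \<alpha>_less \<alpha>_nonneg by (intro exI[of _ 1]) (simp add: frac_eq)
    next
      case 2
      then show ?thesis by (intro exI[of _ "int (n j)"]) (simp add: p_def)
    qed
  qed
  then obtain m :: int where "frac (t + of_int i * \<alpha>) = frac (of_int m * \<alpha>)" ..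
  then obtain a where "t + of_int i * \<alpha> = of_int m * \<alpha> + of_int a" by (rule frac_eqE)
  then have "t = \<alpha> + of_int (m - 1 - i) * \<alpha> + of_int a" by (simp add: algebra_simps)
  then show ?thesis using that frac_add_of_int_right by metis
qed

lemma frac_orbit_eq_iff: "frac (of_int a * \<alpha>) = frac (of_int b * \<alpha>) \<longleftrightarrow> a = b"
proof
  assume "frac (of_int a * \<alpha>) = frac (of_int b * \<alpha>)"
  then obtain c where "of_int a * \<alpha> = of_int b * \<alpha> + of_int c" by (rule frac_eqE)
  then have "of_int (a - b) * \<alpha> = of_int c" by (simp add: algebra_simps)
  then have "a - b = 0" by (rule int_multiple_eq)
  then show "a = b" by simp
qed simp

lemma \<alpha>_orbit_eq_\<alpha>: "frac (\<alpha> + of_int i * \<alpha>) = \<alpha> \<longleftrightarrow> i = 0"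
proof -
  have "frac \<alpha> = \<alpha>" using \<alpha>_less \<alpha>_nonneg by (simp add: frac_eq)
  moreover have "of_int (i + 1) * \<alpha> = \<alpha> + of_int i * \<alpha>" by (simp add: algebra_simps)
  ultimately show ?thesis using frac_orbit_eq_iff[of "i + 1" 1] by simp
qed

lemma \<alpha>_orbit_eq_p: "frac (\<alpha> + of_int i * \<alpha>) = p j \<longleftrightarrow> i = int (n j) - 1"
proof -
  have "of_int (i + 1) * \<alpha> = \<alpha> + of_int i * \<alpha>" by (simp add: algebra_simps)
  then have "frac (\<alpha> + of_int i * \<alpha>) = p j \<longleftrightarrow> i + 1 = int (n j)"
    using frac_orbit_eq_iff[of "i + 1" "int (n j)"] by (simp add: p_def)
  then show ?thesis by linarith
qed

lemma \<alpha>_orbit_ne_\<beta>: "1 \<le> j \<Longrightarrow> frac (\<alpha> + of_int i * \<alpha>) \<noteq> \<beta> j"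
  using \<beta>_hit_unique[of j \<alpha> i 0] \<alpha>_orbit_eq_\<alpha>[of 0] \<beta>_notin_int_comb[of j 0 1]
  by (auto simp: jump_def)

lemma jump_\<alpha>_orbit: "jump (\<alpha> + of_int i * \<alpha>) \<longleftrightarrow> i = 0 \<or> (\<exists>j\<ge>1. i = int (n j) - 1)"
  using \<alpha>_orbit_ne_\<beta> by (auto simp: jump_def \<alpha>_orbit_eq_\<alpha> \<alpha>_orbit_eq_p)

lemma n_ge: "1 \<le> j \<Longrightarrow> j \<le> n j"
proof (induction j)
  case (Suc j)
  show ?case
  proof (cases "j = 0")
    case True
    have "n 1 \<noteq> 0"
      using \<alpha>_less_p[of 1] \<alpha>_pos by (cases "n 1 = 0") (auto simp: p_def)
    then show ?thesis using True by simp
  next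
    case False
    then have "n j < n (Suc j)" using n_mono by (intro strict_mono_onD[OF n_mono]) auto
    then show ?thesis using Suc False by simp
  qed
qed simp

lemma n_ne_1: assumes "1 \<le> j" shows "n j \<noteq> 1"
proof
  assume "n j = 1"
  then have "p j = \<alpha>" using \<alpha>_less \<alpha>_nonneg by (simp add: p_def frac_eq)
  then show False using \<alpha>_less_p[OF assms] by simp
qed

definition jump_times :: "int set" where "jump_times = {int (n j) - 1 | j. 1 \<le> j}"

lemma zero_notin_jump_times: "0 \<notin> jump_times"
  using n_ne_1 by (force simp: jump_times_def)

lemma jump_times_unbounded: "\<exists>i\<in>jump_times. M \<le> i"
  using n_ge[of "nat M + 1"]
  by (intro bexI[of _ "int (n (nat M + 1)) - 1"]) (auto simp: jump_times_def)

text \<open>For a gap \<open>g = n b - n a\<close> the fractional part of \<open>g\<alpha>\<close> is \<open>1 - (p a - p b)\<close>, which tends to 1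
  as \<open>a\<close> grows. For \<open>g\<close> in a finite range it stays away from 1, because fractional parts are below 1.\<close>
lemma sparse_jump_times: "sparse jump_times"
  unfolding sparse_def
proof
  fix L :: int
  have "\<forall>\<^sub>F j in sequentially. \<forall>g\<in>{1..L}. p j < \<alpha> + (1 - frac (of_int g * \<alpha>))"
    by (intro eventually_ball_finite ballI order_tendstoD(2)[OF p_tendsto]) (auto simp: frac_lt_1)
  then have "\<forall>\<^sub>F j in sequentially. 1 \<le> j \<and> (\<forall>g\<in>{1..L}. p j < \<alpha> + (1 - frac (of_int g * \<alpha>)))"
    using eventually_ge_at_top by (rule eventually_conj[rotated])
  then obtain J where J: "1 \<le> J"
      "\<And>j g. J \<le> j \<Longrightarrow> 1 \<le> g \<Longrightarrow> g \<le> L \<Longrightarrow> p j < \<alpha> + (1 - frac (of_int g * \<alpha>))"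
    unfolding eventually_sequentially by (meson atLeastAtMost_iff order_refl)
  have mono: "n a < n b \<longleftrightarrow> a < b" if "1 \<le> a" "1 \<le> b" for a b
    using strict_mono_on_less[OF n_mono, of a b] that by auto
  have "L < int (n b) - int (n a)" if ab: "1 \<le> a" "1 \<le> b" "n J \<le> n a" "n a < n b" for a b
  proof (rule ccontr)
    define g where "g = int (n b) - int (n a)"
    assume "\<not> L < int (n b) - int (n a)"
    then have g: "1 \<le> g" "g \<le> L" using ab by (auto simp: g_def)
    have "J \<le> a" "a < b" using mono[of a J] mono[of a b] ab J(1) by auto
    then have "p b < p a" "\<alpha> < p b" using p_antimono \<alpha>_less_p ab by auto
    then have "frac (real (n b) * \<alpha> - real (n a) * \<alpha>) = p b + 1 - p a"
      unfolding p_def by (intro frac_diff_neg)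
    then have "frac (of_int g * \<alpha>) = p b + 1 - p a" by (simp add: g_def algebra_simps)
    then show False using J(2)[OF \<open>J \<le> a\<close> g] \<open>\<alpha> < p b\<close> by simp
  qed
  then show "\<exists>M. \<forall>i\<in>jump_times. \<forall>j\<in>jump_times. M \<le> i \<and> i < j \<longrightarrow> L < j - i"
    by (intro exI[of _ "int (n J) - 1"]) (auto simp: jump_times_def)
qed

text \<open>The displacement is to the left if some \<open>\<beta> j\<close> is met within the window, which then is
  the only boundary point met by the orbit, and to the right otherwise. To the right all the \<open>p j\<close> keep their symbol, and
  one can fall into an interval of \<open>K\<close> at the single time at which \<open>\<alpha>\<close> is met.\<close>
lemma approach_settled:
  assumes "\<delta> > 0"
  obtains h where "\<bar>h\<bar> < \<delta>" "\<And>i. \<bar>i\<bar> \<le> int N \<Longrightarrow> settled (visits (s + of_int i * \<alpha>)) (s + of_int i * \<alpha> + h)"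
proof -
  let ?u = "\<lambda>i::int. s + of_int i * \<alpha>"
  let ?good = "\<lambda>i h. settled (visits (?u i)) (?u i + h)"
  have nj: "\<not> jump (?u i) \<Longrightarrow> \<forall>\<^sub>F h in at 0 within S. ?good i h" for i S
    by (rule filter_leD[OF at_within_le_nhds settled_eventually[OF settled_if_not_jump]])
  have small_right: "\<forall>\<^sub>F h in at_right (0::real). \<bar>h\<bar> < \<delta>"
    using \<open>\<delta> > 0\<close> by (auto simp: eventually_at_right_field)
  have small_left: "\<forall>\<^sub>F h in at_left (0::real). \<bar>h\<bar> < \<delta>"
    using \<open>\<delta> > 0\<close> by (auto simp: eventually_at_left_field intro!: exI[of _ "- \<delta>"])
  have fin: "finite {- int N..int N}" by simp
  have "\<exists>h. \<bar>h\<bar> < \<delta> \<and> (\<forall>i\<in>{- int N..int N}. ?good i h)"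
  proof (cases "\<exists>i\<in>{- int N..int N}. \<exists>j\<ge>1. frac (?u i) = \<beta> j")
    case True
    then obtain i0 j where i0: "1 \<le> j" "frac (?u i0) = \<beta> j" by blast
    have "\<forall>\<^sub>F h in at_left 0. ?good i h" for i
      using \<beta>_hit_unique[OF i0] \<beta>_left[OF i0] visits_\<beta>[OF i0] nj by (cases "i = i0") auto
    then have "\<forall>\<^sub>F h in at_left 0. \<forall>i\<in>{- int N..int N}. ?good i h"
      by (intro eventually_ball_finite[OF fin]) auto
    with small_left have "\<forall>\<^sub>F h in at_left 0. \<bar>h\<bar> < \<delta> \<and> (\<forall>i\<in>{- int N..int N}. ?good i h)"
      by (rule eventually_conj)
    then show ?thesis using eventually_happens'[OF trivial_limit_at_left_real] by blast
  next
    case no_\<beta>: False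
    define A where "A = {i \<in> {- int N..int N}. frac (?u i) \<noteq> \<alpha>}"
    have "\<forall>\<^sub>F h in at_right 0. ?good i h" if i: "i \<in> A" for i
    proof (cases "jump (?u i)")
      case True
      then obtain j where "1 \<le> j" "frac (?u i) = p j"
        using i no_\<beta> unfolding jump_def A_def by blast
      then show ?thesis using p_right visits_p by simp
    qed (rule nj)
    then have "\<forall>\<^sub>F h in at_right 0. \<forall>i\<in>A. ?good i h"
      by (intro eventually_ball_finite finite_subset[OF _ fin, of A]) (auto simp only: A_def)
    with small_right have ev: "\<forall>\<^sub>F h in at_right 0. \<bar>h\<bar> < \<delta> \<and> (\<forall>i\<in>A. ?good i h)"
      by (rule eventually_conj)
    show ?thesis
    proof (cases "\<exists>i. frac (?u i) = \<alpha>")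
      case True
      then obtain i0 where i0: "frac (?u i0) = \<alpha>" ..
      have uniq: "i = i0" if i: "frac (?u i) = \<alpha>" for i
      proof -
        obtain a where "\<alpha> = \<alpha> + (of_int a + of_int (i - i0) * \<alpha>)"
          using frac_eq_orbit[of s i i0] i0 i by metis
        then have "of_int (i - i0) * \<alpha> = of_int (- a)" by simp
        then have "i - i0 = 0" by (rule int_multiple_eq)
        then show ?thesis by simp
      qed
      have "\<exists>\<^sub>F h in at_right 0. settled True (?u i0 + h)" by (rule \<alpha>_right[OF i0])
      then have "\<exists>\<^sub>F h in at_right 0. (\<bar>h\<bar> < \<delta> \<and> (\<forall>i\<in>A. ?good i h)) \<and> settled True (?u i0 + h)"
        using ev by (rule frequently_eventually_conj)
      then obtain h where h: "settled True (?u i0 + h)" "\<bar>h\<bar> < \<delta>" "\<forall>i\<in>A. ?good i h"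
        using frequently_ex by blast
      have "?good i h" if "i \<in> {- int N..int N}" for i
        using h that uniq visits_\<alpha>[OF i0] by (cases "frac (?u i) = \<alpha>") (auto simp: A_def)
      then show ?thesis using h by blast
    next
      case False
      then have "A = {- int N..int N}" by (auto simp: A_def)
      then show ?thesis using ev eventually_happens'[OF trivial_limit_at_right_real] by blast
    qed
  qed
  then show ?thesis using that by (auto simp: abs_le_iff)
qed

end

section \<open>The system as a set of limits of codings; minimality\<close>

definition differ :: "'b \<times> (int \<Rightarrow> bool) \<Rightarrow> 'b \<times> (int \<Rightarrow> bool) \<Rightarrow> int set" where
  "differ z w = {i. snd z i \<noteq> snd w i}"

context interval_coding
begin

abbreviation Z where "Z \<equiv> Z_set \<alpha> n \<beta>"
abbreviation F where "F \<equiv> F_map \<alpha>"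

lemma int_iter_rotation:
  assumes t: "t \<in> {0..<1}"
  shows "int_iter {0..<1} (rotation \<alpha>) i t = frac (t + of_int i * \<alpha>)"
proof (rule int_iter_eq_flow[where \<Phi> = "\<lambda>i t. frac (t + of_int i * \<alpha>)"])
  show "inj_on (rotation \<alpha>) {0..<1}"
  proof (rule inj_onI)
    fix s t :: real assume st: "s \<in> {0..<1}" "t \<in> {0..<1}" "rotation \<alpha> s = rotation \<alpha> t"
    then obtain k where "s + \<alpha> = t + \<alpha> + of_int k" unfolding rotation_def by (metis frac_eqE)
    moreover from this have "k = 0" using st by auto
    ultimately show "s = t" by simp
  qed
qed (use t in \<open>auto simp: frac_lt_1 rotation_def algebra_simps\<close>)

lemma coding_eq: "t \<in> {0..<1} \<Longrightarrow> coding \<alpha> n \<beta> t i = visits (t + of_int i * \<alpha>)"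
  by (simp add: coding_def int_iter_rotation visits_def)

lemma Z_iff:
  "(t, x) \<in> Z \<longleftrightarrow> t \<in> {0..<1} \<and>
     (\<forall>\<delta>>0. \<forall>N::nat. \<exists>h. \<bar>h\<bar> < \<delta> \<and> (\<forall>i. \<bar>i\<bar> \<le> int N \<longrightarrow> visits (t + of_int i * \<alpha> + h) = x i))"
proof -
  have "coding \<alpha> n \<beta> (frac (t + h)) i = visits (t + of_int i * \<alpha> + h)" for h i
    using visits_cong[of "frac (t + h) + of_int i * \<alpha>" "t + of_int i * \<alpha> + h"]
    by (subst coding_eq) (auto simp: frac_lt_1 algebra_simps)
  moreover have "(frac (t + h), y) \<in> {(t, coding \<alpha> n \<beta> t) | t. t \<in> {0..<1}} \<longleftrightarrow>
      y = coding \<alpha> n \<beta> (frac (t + h))" for h y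
    by (auto simp: frac_lt_1)
  ultimately show ?thesis
    unfolding Z_set_def closure_of_circle_shift_iff by simp
qed

text \<open>Where the coding is locally constant, all points of the fibre share its symbol.\<close>
lemma Z_settled:
  assumes Z: "(t, x) \<in> Z" and b: "settled b (t + of_int i * \<alpha>)" shows "x i = b"
proof -
  obtain d where "d > 0" and d: "\<And>h. \<bar>h\<bar> < d \<Longrightarrow> settled b (t + of_int i * \<alpha> + h)"
    using settled_eventually[OF b] by (auto simp: eventually_nhds_metric)
  obtain h where "\<bar>h\<bar> < d" "\<forall>k. \<bar>k\<bar> \<le> int (nat \<bar>i\<bar>) \<longrightarrow> visits (t + of_int k * \<alpha> + h) = x k"
    using Z \<open>d > 0\<close> unfolding Z_iff by blast
  then show ?thesis using settled_visits[OF d] by auto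
qed

text \<open>The flow of \<open>F\<close> by integer times, given by a formula that makes sense off \<open>Z\<close> too.\<close>
definition flow :: "int \<Rightarrow> real \<times> (int \<Rightarrow> bool) \<Rightarrow> real \<times> (int \<Rightarrow> bool)" where
  "flow i z = (frac (fst z + of_int i * \<alpha>), \<lambda>k. snd z (k + i))"

lemma fst_flow [simp]: "fst (flow i z) = frac (fst z + of_int i * \<alpha>)"
  and snd_flow [simp]: "snd (flow i z) k = snd z (k + i)"
  by (simp_all add: flow_def)

lemma flow_flow: "flow i (flow j z) = flow (i + j) z"
  by (simp add: flow_def algebra_simps)

lemma flow_0: "z \<in> Z \<Longrightarrow> flow 0 z = z"
  by (cases z) (auto simp: flow_def Z_iff)

lemma flow_in_Z:
  assumes "z \<in> Z" shows "flow i z \<in> Z"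
proof -
  obtain t x where z: "z = (t, x)" by (cases z)
  have "\<exists>h. \<bar>h\<bar> < \<delta> \<and> (\<forall>k. \<bar>k\<bar> \<le> int N \<longrightarrow>
        visits (frac (t + of_int i * \<alpha>) + of_int k * \<alpha> + h) = x (k + i))"
    if \<delta>: "\<delta> > 0" for \<delta> and N :: nat
  proof -
    obtain h where h: "\<bar>h\<bar> < \<delta>"
      "\<And>k. \<bar>k\<bar> \<le> int (N + nat \<bar>i\<bar>) \<Longrightarrow> visits (t + of_int k * \<alpha> + h) = x k"
      using assms \<delta> unfolding z Z_iff by blast
    have "visits (frac (t + of_int i * \<alpha>) + of_int k * \<alpha> + h) = x (k + i)" if "\<bar>k\<bar> \<le> int N" for k
    proof -
      have "visits (frac (t + of_int i * \<alpha>) + of_int k * \<alpha> + h) = visits (t + of_int (k + i) * \<alpha> + h)"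
        unfolding add.assoc[of "frac _"] by (intro visits_cong frac_frac_add) (simp add: algebra_simps)
      also have "\<dots> = x (k + i)" using that by (intro h) auto
      finally show ?thesis .
    qed
    then show ?thesis using h by blast
  qed
  then show ?thesis by (auto simp: flow_def z Z_iff frac_lt_1)
qed

lemma F_flow: "F z = flow 1 z"
  by (cases z) (simp add: F_map_def flow_def rotation_def shift_def)

lemma int_iter_F:
  assumes "z \<in> Z" shows "int_iter Z F i z = flow i z"
proof (rule int_iter_eq_flow[where \<Phi> = flow])
  show "inj_on F Z"
    by (rule inj_on_inverseI[of _ "flow (- 1)"]) (simp add: F_flow flow_flow flow_0)
qed (use assms in \<open>auto simp: flow_in_Z flow_0 F_flow flow_flow add.commute\<close>)

lemma funpow_F: "z \<in> Z \<Longrightarrow> (F ^^ m) z = flow (int m) z"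
  using int_iter_F[of z "int m"] by (simp add: int_iter_def)

text \<open>Given a target \<open>(s, y)\<close> and a window, three small displacements are made: \<open>h1\<close> to a point whose coding
  has the window of \<open>y\<close>, \<open>h2\<close> to a point around which this window is constant, and \<open>h3\<close> to a point of
  the forward orbit. As the window is constant near that last point, every point of \<open>Z\<close> over it,
  in particular the one in \<open>A\<close>, has this window.\<close>
lemma minimal: "minimal_system (Z_top \<alpha> n \<beta>) F"
  unfolding minimal_system_def
proof (intro allI impI)
  fix A assume A: "closedin (Z_top \<alpha> n \<beta>) A \<and> F ` A \<subseteq> A"
  then have AZ: "A \<subseteq> Z" using closedin_subset by fastforce
  show "A = {} \<or> A = topspace (Z_top \<alpha> n \<beta>)"
  proof (cases "A = {}")
    case False
    then obtain z where z: "z \<in> A" by blast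
    then obtain t x where tx: "z = (t, x)" by (cases z)
    have orbit: "flow (int m) z \<in> A" for m
    proof (induction m)
      case 0
      then show ?case using z flow_0[of z] AZ by auto
    next
      case (Suc m)
      then have "F (flow (int m) z) \<in> A" using A by blast
      then show ?case by (simp add: F_flow flow_flow)
    qed
    have "(s, y) \<in> A" if sy: "(s, y) \<in> Z" for s y
    proof -
      have "(s, y) \<in> prod_topology circle full_shift closure_of A"
        unfolding closure_of_circle_shift_iff
      proof (intro conjI allI impI)
        show "s \<in> {0..<1}" using sy by (simp add: Z_iff)
        fix \<delta> :: real and N :: nat assume "\<delta> > 0"
        then have \<delta>: "\<delta> / 3 > 0" by simp
        obtain h1 where h1: "\<bar>h1\<bar> < \<delta> / 3"
          "\<And>i. \<bar>i\<bar> \<le> int N \<Longrightarrow> visits (s + of_int i * \<alpha> + h1) = y i"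
          using sy \<delta> unfolding Z_iff by blast
        obtain h2 where h2: "\<bar>h2\<bar> < \<delta> / 3"
          "\<And>i. \<bar>i\<bar> \<le> int N \<Longrightarrow> settled (visits (s + h1 + of_int i * \<alpha>)) (s + h1 + of_int i * \<alpha> + h2)"
          using approach_settled[OF \<delta>, of N "s + h1"] by blast
        have "\<forall>\<^sub>F h in nhds 0. settled (y i) (s + h1 + h2 + of_int i * \<alpha> + h)"
          if "\<bar>i\<bar> \<le> int N" for i
          using settled_eventually[OF h2(2)[OF that]] h1(2)[OF that] by (simp add: algebra_simps)
        then have "\<forall>\<^sub>F h in nhds 0. \<forall>i\<in>{- int N..int N}. settled (y i) (s + h1 + h2 + of_int i * \<alpha> + h)"
          by (intro eventually_ball_finite) auto
        then obtain d where "d > 0" and d: "\<And>h i. \<bar>h\<bar> < d \<Longrightarrow> \<bar>i\<bar> \<le> int N \<Longrightarrow>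
            settled (y i) (s + h1 + h2 + of_int i * \<alpha> + h)"
          unfolding eventually_nhds_metric by (auto simp: abs_le_iff)
        obtain q m where "m > 0"
          and qm: "\<bar>of_int m * \<alpha> - of_int q - (s + h1 + h2 - t)\<bar> < min d (\<delta> / 3)"
          using sequence_of_fractional_parts_is_dense[OF \<alpha>_irrational, of "min d (\<delta> / 3)"]
            \<open>d > 0\<close> \<delta> by (metis min_less_iff_conj)
        define h3 where "h3 = of_int m * \<alpha> - of_int q - (s + h1 + h2 - t)"
        have h3: "\<bar>h3\<bar> < d" "\<bar>h3\<bar> < \<delta> / 3" using qm by (auto simp: h3_def)
        have mod1: "t + of_int m * \<alpha> = s + (h1 + h2 + h3) + of_int q" by (simp add: h3_def)
        have inA: "(frac (s + (h1 + h2 + h3)), \<lambda>k. x (k + m)) \<in> A"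
          using orbit[of "nat m"] \<open>m > 0\<close> by (simp add: flow_def tx mod1)
        have "x (i + m) = y i" if i: "\<bar>i\<bar> \<le> int N" for i
        proof -
          have "settled (y i) (s + h1 + h2 + of_int i * \<alpha> + h3)" by (rule d[OF h3(1) i])
          then have "settled (y i) (frac (s + (h1 + h2 + h3)) + of_int i * \<alpha>)"
            by (rule settled_cong[OF frac_frac_add, rotated]) (simp add: algebra_simps)
          then show ?thesis using Z_settled inA AZ by blast
        qed
        then show "\<exists>h v. \<bar>h\<bar> < \<delta> \<and> (frac (s + h), v) \<in> A \<and> (\<forall>i. \<bar>i\<bar> \<le> int N \<longrightarrow> v i = y i)"
          using inA h1 h2 h3 by (intro exI[of _ "h1 + h2 + h3"] exI[of _ "\<lambda>k. x (k + m)"]) auto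
      qed
      then have "(s, y) \<in> Z_top \<alpha> n \<beta> closure_of A"
        using sy AZ by (simp add: Z_top_def closure_of_subtopology inf.absorb2)
      then show ?thesis using A closure_of_closedin by blast
    qed
    then show ?thesis using AZ by auto
  qed simp
qed

section \<open>The fibre over \<open>\<alpha>\<close>\<close>

lemma special_seq_eq:
  "special_seq \<alpha> n \<beta> v\<^sub>0 v i =
    (if i = 0 then v\<^sub>0 else if i \<in> jump_times then v else visits (\<alpha> + of_int i * \<alpha>))"
proof -
  have iff: "i \<in> jump_times \<longleftrightarrow> (\<exists>j>0. i = int (n j) - 1)"
    by (auto simp: jump_times_def Suc_le_eq)
  then show ?thesis
    unfolding special_seq_def iff[symmetric] using n_0 \<alpha>_nonneg \<alpha>_less by (simp add: coding_eq)
qed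

lemma jump_times_frac:
  assumes "i \<in> jump_times" obtains j where "1 \<le> j" "frac (\<alpha> + of_int i * \<alpha>) = p j"
  using assms unfolding jump_times_def \<alpha>_orbit_eq_p by blast

lemma not_jump_\<alpha>_orbit: "i \<noteq> 0 \<Longrightarrow> i \<notin> jump_times \<Longrightarrow> \<not> jump (\<alpha> + of_int i * \<alpha>)"
  by (auto simp: jump_\<alpha>_orbit jump_times_def)

lemma frac_\<alpha>: "frac (\<alpha> + of_int 0 * \<alpha>) = \<alpha>"
  using \<alpha>_orbit_eq_\<alpha> by blast

lemma special_seq_left:
  "\<forall>\<^sub>F h in at_left 0. settled (special_seq \<alpha> n \<beta> False False i) (\<alpha> + of_int i * \<alpha> + h)"
proof -
  consider "i = 0" | "i \<noteq> 0" "i \<in> jump_times" | "i \<noteq> 0" "i \<notin> jump_times" by blast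
  then show ?thesis
  proof cases
    case 1
    then show ?thesis using \<alpha>_left[OF frac_\<alpha>] by (simp add: special_seq_eq)
  next
    case 2
    then show ?thesis using p_left jump_times_frac[of i] by (metis special_seq_eq)
  next
    case 3
    then show ?thesis
      using filter_leD[OF at_within_le_nhds settled_eventually[OF settled_if_not_jump[OF not_jump_\<alpha>_orbit[OF 3]]]]
      by (simp add: special_seq_eq)
  qed
qed

lemma special_seq_right:
  assumes "i \<noteq> 0"
  shows "\<forall>\<^sub>F h in at_right 0. settled (special_seq \<alpha> n \<beta> v True i) (\<alpha> + of_int i * \<alpha> + h)"
proof (cases "i \<in> jump_times")
  case True
  then show ?thesis using p_right jump_times_frac[of i] assms by (metis special_seq_eq)
next
  case False
  then show ?thesis
    using filter_leD[OF at_within_le_nhds settled_eventually[OF settled_if_not_jump[OF not_jump_\<alpha>_orbit[OF assms False]]]]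
      assms by (simp add: special_seq_eq)
qed

lemma z_minus_in_Z: "z_minus \<alpha> n \<beta> \<in> Z"
  unfolding z_minus_def Z_iff
proof (intro conjI allI impI)
  show "\<alpha> \<in> {0..<1}" using \<alpha>_nonneg \<alpha>_less by simp
  fix \<delta> :: real and N :: nat assume "\<delta> > 0"
  then have small: "\<forall>\<^sub>F h in at_left (0::real). \<bar>h\<bar> < \<delta>"
    by (auto simp: eventually_at_left_field intro!: exI[of _ "- \<delta>"])
  have "\<forall>\<^sub>F h in at_left 0. \<forall>i\<in>{- int N..int N}.
      settled (special_seq \<alpha> n \<beta> False False i) (\<alpha> + of_int i * \<alpha> + h)"
    by (intro eventually_ball_finite ballI special_seq_left) simp
  with small have "\<forall>\<^sub>F h in at_left 0. \<bar>h\<bar> < \<delta> \<and> (\<forall>i\<in>{- int N..int N}.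
      settled (special_seq \<alpha> n \<beta> False False i) (\<alpha> + of_int i * \<alpha> + h))"
    by (rule eventually_conj)
  then obtain h where "\<bar>h\<bar> < \<delta>" "\<forall>i\<in>{- int N..int N}.
      settled (special_seq \<alpha> n \<beta> False False i) (\<alpha> + of_int i * \<alpha> + h)"
    using eventually_happens'[OF trivial_limit_at_left_real] by blast
  then show "\<exists>h. \<bar>h\<bar> < \<delta> \<and> (\<forall>i. \<bar>i\<bar> \<le> int N \<longrightarrow>
      visits (\<alpha> + of_int i * \<alpha> + h) = special_seq \<alpha> n \<beta> False False i)"
    by (intro exI[of _ h] conjI allI impI settled_visits) (auto simp: abs_le_iff)
qed

lemma plus_in_Z: "(\<alpha>, special_seq \<alpha> n \<beta> v True) \<in> Z"
  unfolding Z_iff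
proof (intro conjI allI impI)
  show "\<alpha> \<in> {0..<1}" using \<alpha>_nonneg \<alpha>_less by simp
  fix \<delta> :: real and N :: nat assume "\<delta> > 0"
  then have small: "\<forall>\<^sub>F h in at_right (0::real). \<bar>h\<bar> < \<delta>"
    by (auto simp: eventually_at_right_field)
  have "\<forall>\<^sub>F h in at_right 0. \<forall>i\<in>{- int N..int N} - {0}.
      settled (special_seq \<alpha> n \<beta> v True i) (\<alpha> + of_int i * \<alpha> + h)"
    by (intro eventually_ball_finite ballI special_seq_right) auto
  with small have "\<forall>\<^sub>F h in at_right 0. \<bar>h\<bar> < \<delta> \<and> (\<forall>i\<in>{- int N..int N} - {0}.
      settled (special_seq \<alpha> n \<beta> v True i) (\<alpha> + of_int i * \<alpha> + h))"
    by (rule eventually_conj)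
  then have "\<exists>\<^sub>F h in at_right 0. (\<bar>h\<bar> < \<delta> \<and> (\<forall>i\<in>{- int N..int N} - {0}.
      settled (special_seq \<alpha> n \<beta> v True i) (\<alpha> + of_int i * \<alpha> + h))) \<and>
      settled v (\<alpha> + of_int 0 * \<alpha> + h)"
    by (rule frequently_eventually_conj[OF \<alpha>_right[OF frac_\<alpha>]])
  from frequently_ex[OF this] obtain h where h: "settled v (\<alpha> + of_int 0 * \<alpha> + h)" "\<bar>h\<bar> < \<delta>"
    "\<forall>i\<in>{- int N..int N} - {0}. settled (special_seq \<alpha> n \<beta> v True i) (\<alpha> + of_int i * \<alpha> + h)"
    by blast
  have "settled (special_seq \<alpha> n \<beta> v True i) (\<alpha> + of_int i * \<alpha> + h)" if "\<bar>i\<bar> \<le> int N" for i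
  proof (cases "i = 0")
    case True
    then show ?thesis using h(1) by (simp add: special_seq_eq)
  next
    case False
    then have "i \<in> {- int N..int N} - {0}" using that by (simp add: abs_le_iff)
    then show ?thesis using h(3) by blast
  qed
  then show "\<exists>h. \<bar>h\<bar> < \<delta> \<and> (\<forall>i. \<bar>i\<bar> \<le> int N \<longrightarrow>
      visits (\<alpha> + of_int i * \<alpha> + h) = special_seq \<alpha> n \<beta> v True i)"
    using h(2) by (intro exI[of _ h] conjI allI impI settled_visits)
qed

text \<open>Approximation from the right, or by \<open>\<alpha>\<close> itself, gives the first alternative; approximation from the
  left gives the second one, which includes time 0. This excludes the fourth conceivable combination,
  symbol 1 at time 0 and symbol 0 at the later jump times.\<close>
lemma fibre_sides:
  assumes Z: "(\<alpha>, x) \<in> Z" and A: "finite A" "A \<subseteq> jump_times"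
  shows "(\<forall>i\<in>A. x i) \<or> (\<forall>i\<in>insert 0 A. \<not> x i)"
proof -
  have "\<forall>\<^sub>F h in at_right 0. \<forall>i\<in>A. visits (\<alpha> + of_int i * \<alpha> + h)"
  proof (intro eventually_ball_finite[OF A(1)] ballI)
    fix i assume "i \<in> A"
    then obtain j where "1 \<le> j" "frac (\<alpha> + of_int i * \<alpha>) = p j"
      using A jump_times_frac by blast
    from p_right[OF this] show "\<forall>\<^sub>F h in at_right 0. visits (\<alpha> + of_int i * \<alpha> + h)"
      by eventually_elim (simp add: settled_visits)
  qed
  then obtain d1 where d1: "d1 > 0" "\<And>h i. 0 < h \<Longrightarrow> h < d1 \<Longrightarrow> i \<in> A \<Longrightarrow> visits (\<alpha> + of_int i * \<alpha> + h)"
    unfolding eventually_at_right_field by blast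
  have "\<forall>\<^sub>F h in at_left 0. \<forall>i\<in>insert 0 A. \<not> visits (\<alpha> + of_int i * \<alpha> + h)"
  proof (intro eventually_ball_finite ballI)
    fix i assume "i \<in> insert 0 A"
    then have "special_seq \<alpha> n \<beta> False False i = False" using A by (auto simp: special_seq_eq)
    with special_seq_left[of i] have "\<forall>\<^sub>F h in at_left 0. settled False (\<alpha> + of_int i * \<alpha> + h)" by simp
    then show "\<forall>\<^sub>F h in at_left 0. \<not> visits (\<alpha> + of_int i * \<alpha> + h)"
      by eventually_elim (simp add: settled_visits)
  qed (use A in simp)
  then obtain d2 where d2: "d2 < 0" "\<And>h i. d2 < h \<Longrightarrow> h < 0 \<Longrightarrow> i \<in> insert 0 A \<Longrightarrow> \<not> visits (\<alpha> + of_int i * \<alpha> + h)"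
    unfolding eventually_at_left_field by blast
  obtain N where N: "\<And>i. i \<in> A \<Longrightarrow> nat \<bar>i\<bar> \<le> N"
    using finite_nat_set_iff_bounded_le[THEN iffD1, OF finite_imageI[OF A(1), of "\<lambda>i. nat \<bar>i\<bar>"]]
    by auto
  obtain h where h: "\<bar>h\<bar> < min d1 (- d2)" "\<And>i. \<bar>i\<bar> \<le> int N \<Longrightarrow> visits (\<alpha> + of_int i * \<alpha> + h) = x i"
    using Z d1(1) d2(1) unfolding Z_iff by (metis min_less_iff_conj neg_0_less_iff_less)
  have hx: "visits (\<alpha> + of_int i * \<alpha> + h) = x i" if "i \<in> insert 0 A" for i
    using N[of i] that by (intro h(2)) auto
  consider "h < 0" | "h = 0" | "h > 0" by linarith
  then show ?thesis
  proof cases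
    case 1
    then show ?thesis using d2(2)[of h] h(1) hx by auto
  next
    case 2
    have "x i" if i: "i \<in> A" for i
    proof -
      obtain j where "1 \<le> j" "frac (\<alpha> + of_int i * \<alpha>) = p j"
        using i A jump_times_frac by blast
      then show ?thesis using visits_p hx[of i] i 2 by simp
    qed
    then show ?thesis by blast
  next
    case 3
    then show ?thesis using d1(2)[of h] h(1) hx by auto
  qed
qed

lemma fibre_\<alpha>:
  assumes Z: "(\<alpha>, x) \<in> Z"
  shows "(\<alpha>, x) \<in> {z_plus1 \<alpha> n \<beta>, z_plus0 \<alpha> n \<beta>, z_minus \<alpha> n \<beta>}"
proof -
  obtain i1 where i1: "i1 \<in> jump_times" using jump_times_unbounded by blast
  have const: "x i = x i1" if "i \<in> jump_times" for i
    using fibre_sides[OF Z, of "{i, i1}"] that i1 by auto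
  have zero: "x i1" if "x 0"
    using fibre_sides[OF Z, of "{i1}"] that i1 by auto
  have "x i = special_seq \<alpha> n \<beta> (x 0) (x i1) i" for i
    using const[of i] Z_settled[OF Z settled_if_not_jump[OF not_jump_\<alpha>_orbit[of i]]]
    by (auto simp: special_seq_eq)
  then have "x = special_seq \<alpha> n \<beta> (x 0) (x i1)" by blast
  then show ?thesis
    using zero by (cases "x 0"; cases "x i1") (auto simp: z_plus1_def z_plus0_def z_minus_def)
qed

lemma differ_flow: "differ (flow k z) (flow k w) = {i. i + k \<in> differ z w}"
  by (auto simp: differ_def)

lemma differ_plus1_minus: "differ (z_plus1 \<alpha> n \<beta>) (z_minus \<alpha> n \<beta>) = insert 0 jump_times"
  and differ_plus0_minus: "differ (z_plus0 \<alpha> n \<beta>) (z_minus \<alpha> n \<beta>) = jump_times"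
  and differ_plus1_plus0: "differ (z_plus1 \<alpha> n \<beta>) (z_plus0 \<alpha> n \<beta>) = {0}"
  using zero_notin_jump_times
  by (auto simp: differ_def z_plus1_def z_plus0_def z_minus_def special_seq_eq split: if_splits)

lemma differ_jump:
  assumes "z \<in> Z" "w \<in> Z" "fst z = fst w" "i \<in> differ z w"
  shows "jump (fst z + of_int i * \<alpha>)"
proof (rule ccontr)
  assume "\<not> jump (fst z + of_int i * \<alpha>)"
  then have "settled (visits (fst z + of_int i * \<alpha>)) (fst z + of_int i * \<alpha>)"
    by (rule settled_if_not_jump)
  then have "snd z i = visits (fst z + of_int i * \<alpha>)" "snd w i = visits (fst z + of_int i * \<alpha>)"
    using Z_settled[of "fst z" "snd z"] Z_settled[of "fst w" "snd w"] assms(1-3)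
    by (metis prod.collapse)+
  then have "snd z i = snd w i" by simp
  then show False using assms(4) by (simp add: differ_def)
qed

text \<open>Recurrence along \<open>k m\<close> repeats two fixed differences \<open>i0 < i1\<close> at the times \<open>i0 + k m\<close> and
  \<open>i1 + k m\<close>, so the distance \<open>i1 - i0\<close> occurs arbitrarily late.\<close>
lemma not_recurrent_if_sparse:
  assumes z: "z \<in> Z" "w \<in> Z" and sparse: "sparse (differ z w)"
    and unb: "\<And>M. \<exists>i\<in>differ z w. M \<le> i"
  shows "\<not> recurrent_pair (Z_top \<alpha> n \<beta>) F z w"
proof
  assume "recurrent_pair (Z_top \<alpha> n \<beta>) F z w"
  then obtain k where k: "filterlim k at_top sequentially"
    and lim: "limitin (Z_top \<alpha> n \<beta>) (\<lambda>m. (F ^^ k m) z) z sequentially"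
      "limitin (Z_top \<alpha> n \<beta>) (\<lambda>m. (F ^^ k m) w) w sequentially"
    by (auto simp: recurrent_pair_def limitin_pairwise o_def)
  have coord: "\<forall>\<^sub>F m in sequentially. snd v (i + int (k m)) = snd v i"
    if v: "v \<in> Z" and "limitin (Z_top \<alpha> n \<beta>) (\<lambda>m. (F ^^ k m) v) v sequentially" for v i
  proof -
    have "limitin (discrete_topology UNIV) (\<lambda>m. snd ((F ^^ k m) v) i) (snd v i) sequentially"
      using continuous_map_limit[OF continuous_map_Z_coordinate that(2)] by (simp add: o_def)
    then have "\<forall>\<^sub>F m in sequentially. snd ((F ^^ k m) v) i \<in> {snd v i}"
      unfolding limitin_def by (elim conjE allE[of _ "{snd v i}"]) simp
    then show ?thesis using that(1) by (simp add: funpow_F)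
  qed
  obtain i0 where i0: "i0 \<in> differ z w" using unb by blast
  obtain i1 where i1: "i1 \<in> differ z w" "i0 + 1 \<le> i1" using unb by blast
  obtain M where M: "\<And>i j. i \<in> differ z w \<Longrightarrow> j \<in> differ z w \<Longrightarrow> M \<le> i \<Longrightarrow> i < j \<Longrightarrow> i1 - i0 < j - i"
    using sparse unfolding sparse_def by metis
  have "\<forall>\<^sub>F m in sequentially. nat (M - i0) \<le> k m"
    using k by (simp add: filterlim_at_top)
  with coord[OF z(1) lim(1), of i0] coord[OF z(1) lim(1), of i1]
    coord[OF z(2) lim(2), of i0] coord[OF z(2) lim(2), of i1]
  have "\<forall>\<^sub>F m in sequentially. False"
  proof eventually_elim
    case (elim m)
    have "i0 + int (k m) \<in> differ z w" "i1 + int (k m) \<in> differ z w"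
      using elim i0 i1 by (auto simp: differ_def)
    then have "i1 - i0 < i1 + int (k m) - (i0 + int (k m))"
      using elim(5) i1(2) by (intro M) auto
    then show False by simp
  qed
  then show False by simp
qed

end

section \<open>Li-Yorke pairs\<close>

locale metrized_interval_coding = interval_coding +
  fixes \<rho>
  assumes compatible: "compatible_metric (Z_top \<alpha> n \<beta>) \<rho>"
begin

sublocale compact_metrized "Z_top \<alpha> n \<beta>" \<rho>
  by unfold_locales (rule compact_space_Z_top, rule compatible)

abbreviation ZZ where "ZZ \<equiv> prod_topology (Z_top \<alpha> n \<beta>) (Z_top \<alpha> n \<beta>)"

lemma continuous_fst_fst: "continuous_map ZZ circle (\<lambda>z. fst (fst z))"
  and continuous_fst_snd: "continuous_map ZZ circle (\<lambda>z. fst (snd z))"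
  and continuous_coordinate_fst: "continuous_map ZZ (discrete_topology UNIV) (\<lambda>z. snd (fst z) i)"
  and continuous_coordinate_snd: "continuous_map ZZ (discrete_topology UNIV) (\<lambda>z. snd (snd z) i)"
  using continuous_map_compose[OF continuous_map_fst continuous_map_Z_fst]
    continuous_map_compose[OF continuous_map_snd continuous_map_Z_fst]
    continuous_map_compose[OF continuous_map_fst continuous_map_Z_coordinate]
    continuous_map_compose[OF continuous_map_snd continuous_map_Z_coordinate]
  by (simp_all add: o_def)

text \<open>The pairs whose circle coordinates differ by the given \<open>\<theta> \<noteq> 0\<close> form a closed invariant set
  that misses the diagonal, so the distance is bounded below along the orbit.\<close>
lemma Li_Yorke_same_fibre:
  assumes "z \<in> Z" "w \<in> Z" and LY: "Li_Yorke \<rho> F z w"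
  shows "fst z = fst w"
proof (rule ccontr)
  assume ne: "fst z \<noteq> fst w"
  define \<theta> where "\<theta> = fst w - fst z"
  have range: "fst z \<in> {0..<1}" "fst w \<in> {0..<1}"
    using assms Z_iff by (metis prod.collapse)+
  let ?C = "{v \<in> topspace ZZ. rotation \<theta> (fst (fst v)) = fst (snd v)}"
  have "continuous_map ZZ circle (\<lambda>v. rotation \<theta> (fst (fst v)))"
    using continuous_map_compose[OF continuous_fst_fst continuous_map_rotation] by (simp add: o_def)
  then have clo: "closedin ZZ ?C"
    by (intro closedin_continuous_maps_eq[OF Hausdorff_circle] continuous_fst_snd)
  have nondiag: "(v, v) \<notin> ?C" for v
  proof
    assume "(v, v) \<in> ?C"
    then have "frac (fst v + \<theta>) = fst v" by (simp add: rotation_def)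
    then have "\<theta> \<in> \<int>" by (simp add: frac_unique_iff)
    then obtain k where "\<theta> = of_int k" by (auto elim: Ints_cases)
    moreover from this have "k = 0" using range by (auto simp: \<theta>_def)
    ultimately show False using ne by (simp add: \<theta>_def)
  qed
  obtain \<epsilon> where "\<epsilon> > 0" and \<epsilon>: "\<And>z w. (z, w) \<in> ?C \<Longrightarrow> \<rho> z w \<ge> \<epsilon>"
    using separated_from_diagonal[OF clo nondiag] by blast
  have shift: "rotation \<theta> (frac (fst z + x)) = frac (fst w + x)" for x
    unfolding rotation_def by (rule frac_frac_add) (simp add: \<theta>_def)
  have "\<rho> ((F ^^ m) z) ((F ^^ m) w) \<ge> \<epsilon>" for m
    using assms shift by (intro \<epsilon>) (simp add: funpow_F flow_in_Z)
  then have "ereal \<epsilon> \<le> liminf (\<lambda>m. ereal (\<rho> ((F ^^ m) z) ((F ^^ m) w)))"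
    by (intro Liminf_bounded) simp
  then show False using LY \<open>\<epsilon> > 0\<close> by (simp add: Li_Yorke_def)
qed

lemma window_metric_small:
  assumes "\<epsilon> > 0"
  obtains N :: nat where "\<And>z w. z \<in> Z \<Longrightarrow> w \<in> Z \<Longrightarrow> fst z = fst w \<Longrightarrow>
    (\<And>i. \<bar>i\<bar> \<le> int N \<Longrightarrow> i \<notin> differ z w) \<Longrightarrow> \<rho> z w < \<epsilon>"
proof -
  define E where "E i = {v \<in> topspace ZZ. snd (fst v) i = snd (snd v) i}" for i
  define C where "C N = {v \<in> topspace ZZ. fst (fst v) = fst (snd v)} \<inter> (\<Inter>i\<in>{- int N..int N}. E i)" for N
  have "closedin ZZ (E i)" for i
    unfolding E_def
    by (intro closedin_continuous_maps_eq[of "discrete_topology UNIV"] continuous_coordinate_fst continuous_coordinate_snd)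
       (simp add: Hausdorff_space_discrete_topology)
  then have clo: "closedin ZZ (C N)" for N
    unfolding C_def
    by (intro closedin_Int closedin_INT closedin_continuous_maps_eq[OF Hausdorff_circle]
        continuous_fst_fst continuous_fst_snd) auto
  have dec: "decseq C" by (auto simp: decseq_def C_def)
  have diag: "z = w" if "\<And>N. (z, w) \<in> C N" for z w
  proof -
    have "(z, w) \<in> E i" for i
    proof -
      have "i \<in> {- int (nat \<bar>i\<bar>)..int (nat \<bar>i\<bar>)}" by auto
      then show ?thesis using that[of "nat \<bar>i\<bar>"] unfolding C_def by blast
    qed
    then have "snd z i = snd w i" for i by (simp add: E_def)
    moreover have "fst z = fst w" using that[of 0] by (auto simp: C_def)
    ultimately show ?thesis by (auto simp: prod_eq_iff)
  qed
  obtain N where N: "\<And>z w. (z, w) \<in> C N \<Longrightarrow> \<rho> z w < \<epsilon>"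
    using small_near_diagonal[OF clo dec diag assms] by blast
  show ?thesis
    by (rule that[of N], rule N) (auto simp: C_def E_def differ_def)
qed

lemma differ_zero_metric_large:
  obtains \<epsilon> where "\<epsilon> > 0" "\<And>z w. z \<in> Z \<Longrightarrow> w \<in> Z \<Longrightarrow> 0 \<in> differ z w \<Longrightarrow> \<rho> z w \<ge> \<epsilon>"
proof -
  let ?P = "\<lambda>a b. {v \<in> topspace ZZ. snd (fst v) 0 \<in> {a}} \<inter> {v \<in> topspace ZZ. snd (snd v) 0 \<in> {b}}"
  let ?C = "?P True False \<union> ?P False True"
  have "closedin ZZ ?C"
    by (intro closedin_Un closedin_Int closedin_continuous_map_preimage[OF continuous_coordinate_fst]
        closedin_continuous_map_preimage[OF continuous_coordinate_snd]) auto
  moreover have "(v, v) \<notin> ?C" for v by auto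
  ultimately obtain \<epsilon> where "\<epsilon> > 0" "\<And>z w. (z, w) \<in> ?C \<Longrightarrow> \<rho> z w \<ge> \<epsilon>"
    using separated_from_diagonal[of ?C] by blast
  then show ?thesis by (intro that[of \<epsilon>]) (auto simp: differ_def)
qed

lemma Li_Yorke_unbounded_differ:
  assumes z: "z \<in> Z" "w \<in> Z" "fst z = fst w" and LY: "Li_Yorke \<rho> F z w"
  shows "\<exists>i\<in>differ z w. M \<le> i"
proof (rule ccontr)
  assume M: "\<not> (\<exists>i\<in>differ z w. M \<le> i)"
  have "limsup (\<lambda>m. ereal (\<rho> ((F ^^ m) z) ((F ^^ m) w))) \<le> 0"
    unfolding Limsup_le_iff
  proof (intro allI impI)
    fix y :: ereal assume "0 < y"
    then obtain \<epsilon> where \<epsilon>: "0 < ereal \<epsilon>" "ereal \<epsilon> < y" using ereal_dense2 by blast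
    then obtain N where N: "\<And>z w. z \<in> Z \<Longrightarrow> w \<in> Z \<Longrightarrow> fst z = fst w \<Longrightarrow>
        (\<And>i. \<bar>i\<bar> \<le> int N \<Longrightarrow> i \<notin> differ z w) \<Longrightarrow> \<rho> z w < \<epsilon>"
      using window_metric_small[of \<epsilon>] by auto
    have "\<rho> ((F ^^ m) z) ((F ^^ m) w) < \<epsilon>" if "nat M + N \<le> m" for m
    proof -
      have "i + int m \<notin> differ z w" if "\<bar>i\<bar> \<le> int N" for i
        using M that \<open>nat M + N \<le> m\<close> by (auto simp: not_le dest!: bspec)
      then show ?thesis using z by (intro N) (auto simp: funpow_F flow_in_Z differ_flow)
    qed
    then have "\<forall>\<^sub>F m in sequentially. \<rho> ((F ^^ m) z) ((F ^^ m) w) < \<epsilon>"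
      by (auto simp: eventually_sequentially)
    then show "\<forall>\<^sub>F m in sequentially. ereal (\<rho> ((F ^^ m) z) ((F ^^ m) w)) < y"
      by eventually_elim (use \<epsilon>(2) in \<open>metis ereal_less_eq(3) less_imp_le order_le_less_trans\<close>)
  qed
  then show False using LY unfolding Li_Yorke_def by (meson leD)
qed

lemma Li_Yorke_if_sparse:
  assumes z: "z \<in> Z" "w \<in> Z" "fst z = fst w" and sparse: "sparse (differ z w)"
    and unb: "\<And>M. \<exists>i\<in>differ z w. M \<le> i"
  shows "Li_Yorke \<rho> F z w"
  unfolding Li_Yorke_def
proof
  let ?r = "\<lambda>m. \<rho> ((F ^^ m) z) ((F ^^ m) w)"
  obtain \<epsilon> where "\<epsilon> > 0" and \<epsilon>: "\<And>z w. z \<in> Z \<Longrightarrow> w \<in> Z \<Longrightarrow> 0 \<in> differ z w \<Longrightarrow> \<rho> z w \<ge> \<epsilon>"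
    using differ_zero_metric_large by blast
  show "limsup (\<lambda>m. ereal (?r m)) > 0"
  proof (rule ccontr)
    assume "\<not> limsup (\<lambda>m. ereal (?r m)) > 0"
    then have "limsup (\<lambda>m. ereal (?r m)) \<le> 0" by (simp add: not_less)
    also have "0 < ereal \<epsilon>" using \<open>\<epsilon> > 0\<close> by simp
    finally have "\<forall>\<^sub>F m in sequentially. ereal (?r m) < ereal \<epsilon>" by (rule Limsup_lessD)
    then obtain M where M: "\<And>m. M \<le> m \<Longrightarrow> ?r m < \<epsilon>" by (auto simp: eventually_sequentially)
    obtain i where "i \<in> differ z w" "int M \<le> i" using unb by blast
    then have "?r (nat i) \<ge> \<epsilon>"
      using z by (intro \<epsilon>) (auto simp: funpow_F flow_in_Z differ_flow)
    moreover have "M \<le> nat i" using \<open>int M \<le> i\<close> by linarith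
    ultimately show False using M[of "nat i"] by simp
  qed
  show "liminf (\<lambda>m. ereal (?r m)) = 0"
  proof (rule antisym)
    have "?r m \<ge> 0" for m by (rule Metric_space.nonneg[OF metric])
    then show "0 \<le> liminf (\<lambda>m. ereal (?r m))" by (intro Liminf_bounded) simp
    show "liminf (\<lambda>m. ereal (?r m)) \<le> 0"
    proof (rule ccontr)
      assume "\<not> liminf (\<lambda>m. ereal (?r m)) \<le> 0"
      then have "0 < liminf (\<lambda>m. ereal (?r m))" by (simp add: not_le)
      from ereal_dense2[OF this] obtain e where e: "0 < ereal e" "ereal e < liminf (\<lambda>m. ereal (?r m))"
        by blast
      then have "\<forall>\<^sub>F m in sequentially. ereal e < ereal (?r m)" by (intro less_LiminfD)
      then obtain M where M: "\<And>m. M \<le> m \<Longrightarrow> e < ?r m" by (auto simp: eventually_sequentially)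
      obtain N where N: "\<And>z w. z \<in> Z \<Longrightarrow> w \<in> Z \<Longrightarrow> fst z = fst w \<Longrightarrow>
          (\<And>i. \<bar>i\<bar> \<le> int N \<Longrightarrow> i \<notin> differ z w) \<Longrightarrow> \<rho> z w < e"
        using window_metric_small[of e] e(1) by auto
      obtain m where m: "int M \<le> m" "\<And>i. \<bar>i\<bar> \<le> int N \<Longrightarrow> m + i \<notin> differ z w"
        using sparse_gap[OF sparse unb] by blast
      have "?r (nat m) < e"
        using z m by (intro N) (auto simp: funpow_F flow_in_Z differ_flow add.commute)
      moreover have "M \<le> nat m" using m(1) by linarith
      ultimately show False using M[of "nat m"] by simp
    qed
  qed
qed

lemma Li_Yorke_orbit_of_special:
  assumes uv: "u \<in> {z_plus0 \<alpha> n \<beta>, z_plus1 \<alpha> n \<beta>}"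
  shows "flow k u \<in> Z" "flow k (z_minus \<alpha> n \<beta>) \<in> Z"
    and "Li_Yorke \<rho> F (flow k u) (flow k (z_minus \<alpha> n \<beta>))"
proof -
  let ?v = "z_minus \<alpha> n \<beta>"
  have "u \<in> Z" using uv plus_in_Z by (auto simp: z_plus0_def z_plus1_def)
  then show Z: "flow k u \<in> Z" "flow k ?v \<in> Z" by (simp_all add: flow_in_Z z_minus_in_Z)
  have sp: "sparse (differ u ?v)" and "jump_times \<subseteq> differ u ?v"
    using uv sparse_jump_times sparse_insert by (auto simp: differ_plus0_minus differ_plus1_minus)
  then have unb: "\<exists>i\<in>differ u ?v. M \<le> i" for M using jump_times_unbounded by blast
  have "\<exists>i\<in>differ (flow k u) (flow k ?v). M \<le> i" for M
  proof -
    obtain i where "i \<in> differ u ?v" "M + k \<le> i" using unb by blast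
    then show ?thesis by (intro bexI[of _ "i - k"]) (auto simp: differ_flow)
  qed
  moreover have "fst (flow k u) = fst (flow k ?v)"
    using uv by (auto simp: z_plus0_def z_plus1_def z_minus_def)
  ultimately show "Li_Yorke \<rho> F (flow k u) (flow k ?v)"
    using Z sparse_shift[OF sp] by (intro Li_Yorke_if_sparse) (simp_all add: differ_flow)
qed

text \<open>Infinitely many differences mean infinitely many boundary times, hence the common circle coordinate is
  on the orbit of \<open>\<alpha>\<close>, and the pair can be moved to the fibre over \<open>\<alpha>\<close>.\<close>
lemma Li_Yorke_special_orbit:
  assumes z: "z \<in> Z" "w \<in> Z" and LY: "Li_Yorke \<rho> F z w"
  obtains k u where "u \<in> {z_plus0 \<alpha> n \<beta>, z_plus1 \<alpha> n \<beta>}" "{z, w} = {flow k u, flow k (z_minus \<alpha> n \<beta>)}"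
proof -
  have fst_eq: "fst z = fst w" by (rule Li_Yorke_same_fibre[OF z LY])
  have unb: "\<exists>i\<in>differ z w. M \<le> i" for M by (rule Li_Yorke_unbounded_differ[OF z fst_eq LY])
  obtain i0 where i0: "i0 \<in> differ z w" using unb by blast
  obtain i1 where i1: "i1 \<in> differ z w" "i0 + 1 \<le> i1" using unb by blast
  then obtain k where k: "frac (fst z) = frac (\<alpha> + of_int k * \<alpha>)"
    using two_jumps_orbit[of i0 i1 "fst z"] differ_jump[OF z fst_eq] i0 by auto
  have "frac (fst z + of_int (- k) * \<alpha>) = frac (frac (fst z) + of_int (- k) * \<alpha>)"
    by (rule frac_frac_add[symmetric]) simp
  also have "\<dots> = frac (\<alpha> + of_int 0 * \<alpha>)" unfolding k by (rule frac_frac_add) simp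
  also have "\<dots> = \<alpha>" by (rule frac_\<alpha>)
  finally have \<alpha>: "frac (fst z + of_int (- k) * \<alpha>) = \<alpha>" .
  define u v where "u = flow (- k) z" and "v = flow (- k) w"
  have zw: "z = flow k u" "w = flow k v"
    using z by (simp_all add: u_def v_def flow_flow flow_0)
  have "u \<in> Z" "v \<in> Z" "fst u = \<alpha>" "fst v = \<alpha>"
    using z \<alpha> fst_eq by (simp_all add: u_def v_def flow_in_Z)
  then have three: "u \<in> {z_plus1 \<alpha> n \<beta>, z_plus0 \<alpha> n \<beta>, z_minus \<alpha> n \<beta>}"
    "v \<in> {z_plus1 \<alpha> n \<beta>, z_plus0 \<alpha> n \<beta>, z_minus \<alpha> n \<beta>}"
    using fibre_\<alpha>[of "snd u"] fibre_\<alpha>[of "snd v"] by (metis prod.collapse)+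
  \<comment> \<open>A difference of \<open>u\<close> and \<open>v\<close> at a nonzero time rules out the pair \<open>z_plus1\<close>, \<open>z_plus0\<close>.\<close>
  obtain i where "i \<in> differ z w" "1 - k \<le> i" using unb by blast
  then have i: "i + k \<in> differ u v" "i + k \<noteq> 0" by (auto simp: zw differ_flow)
  have sym: "differ a b = differ b a" for a b :: "real \<times> (int \<Rightarrow> bool)" by (auto simp: differ_def)
  have "u \<noteq> v" using i by (auto simp: differ_def)
  moreover have "{u, v} \<noteq> {z_plus1 \<alpha> n \<beta>, z_plus0 \<alpha> n \<beta>}"
    using i differ_plus1_plus0 sym by (metis doubleton_eq_iff singletonD)
  ultimately show ?thesis
    using three that[of "z_plus0 \<alpha> n \<beta>" k] that[of "z_plus1 \<alpha> n \<beta>" k] unfolding zw by blast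
qed

lemma pair_orbit_eq:
  "u \<in> Z \<Longrightarrow> v \<in> Z \<Longrightarrow> pair_orbit Z F u v = range (\<lambda>k. {flow k u, flow k v})"
  by (auto simp: pair_orbit_def int_iter_F)

lemma Li_Yorke_pairs_eq:
  "Li_Yorke_pairs (Z_top \<alpha> n \<beta>) \<rho> F =
     pair_orbit Z F (z_plus0 \<alpha> n \<beta>) (z_minus \<alpha> n \<beta>) \<union>
     pair_orbit Z F (z_plus1 \<alpha> n \<beta>) (z_minus \<alpha> n \<beta>)"
  (is "?LY = ?orbits")
proof -
  have orbits: "?orbits = {{flow k u, flow k (z_minus \<alpha> n \<beta>)} | k u.
      u \<in> {z_plus0 \<alpha> n \<beta>, z_plus1 \<alpha> n \<beta>}}"
    using plus_in_Z z_minus_in_Z by (auto simp: pair_orbit_eq z_plus0_def z_plus1_def)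
  show ?thesis
    unfolding orbits
  proof (intro subset_antisym subsetI)
    fix P assume "P \<in> ?LY"
    then obtain z w where zw: "P = {z, w}" "z \<in> Z" "w \<in> Z" "Li_Yorke \<rho> F z w"
      by (auto simp: Li_Yorke_pairs_def)
    from Li_Yorke_special_orbit[OF zw(2-4)]
    show "P \<in> {{flow k u, flow k (z_minus \<alpha> n \<beta>)} | k u. u \<in> {z_plus0 \<alpha> n \<beta>, z_plus1 \<alpha> n \<beta>}}"
      unfolding zw(1) by blast
  next
    fix P assume "P \<in> {{flow k u, flow k (z_minus \<alpha> n \<beta>)} | k u. u \<in> {z_plus0 \<alpha> n \<beta>, z_plus1 \<alpha> n \<beta>}}"
    then obtain k u where P: "P = {flow k u, flow k (z_minus \<alpha> n \<beta>)}"
      and u: "u \<in> {z_plus0 \<alpha> n \<beta>, z_plus1 \<alpha> n \<beta>}" by blast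
    show "P \<in> ?LY"
      using Li_Yorke_orbit_of_special[OF u, of k] unfolding P Li_Yorke_pairs_def topspace_Z_top by blast
  qed
qed

lemma countable_Li_Yorke_pairs: "countable (Li_Yorke_pairs (Z_top \<alpha> n \<beta>) \<rho> F)"
  unfolding Li_Yorke_pairs_eq
  using plus_in_Z z_minus_in_Z by (simp add: pair_orbit_eq z_plus0_def z_plus1_def)

lemma no_strong_Li_Yorke_pairs: "strong_Li_Yorke_pairs (Z_top \<alpha> n \<beta>) \<rho> F = {}"
proof -
  have "\<not> recurrent_pair (Z_top \<alpha> n \<beta>) F z w"
    if zw: "z \<in> Z" "w \<in> Z" "Li_Yorke \<rho> F z w" for z w
  proof (rule not_recurrent_if_sparse[OF zw(1,2)])
    obtain k u where u: "u \<in> {z_plus0 \<alpha> n \<beta>, z_plus1 \<alpha> n \<beta>}"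
      and eq: "{z, w} = {flow k u, flow k (z_minus \<alpha> n \<beta>)}"
      by (rule Li_Yorke_special_orbit[OF zw])
    have "sparse (differ u (z_minus \<alpha> n \<beta>))"
      using u sparse_jump_times sparse_insert by (auto simp: differ_plus0_minus differ_plus1_minus)
    then have "sparse (differ (flow k u) (flow k (z_minus \<alpha> n \<beta>)))"
      unfolding differ_flow by (rule sparse_shift)
    moreover have "differ z w = differ w z" by (auto simp: differ_def)
    ultimately show "sparse (differ z w)" using eq by (auto simp: doubleton_eq_iff)
    show "\<exists>i\<in>differ z w. M \<le> i" for M
      by (rule Li_Yorke_unbounded_differ[OF zw(1,2) Li_Yorke_same_fibre[OF zw] zw(3)])
  qed
  then show ?thesis by (auto simp: strong_Li_Yorke_pairs_def)
qed

end

theorem mainTheorem18: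
  fixes \<alpha> :: real and n :: "nat \<Rightarrow> nat" and \<beta> :: "nat \<Rightarrow> real"
  assumes "0 \<le> \<alpha>" and "\<alpha> < 1" and "\<alpha> \<notin> \<rat>"
    and "n 0 = 1"
    and "\<forall>j\<ge>1. n j > 0"
    and "strict_mono_on {1..} n"
    and "strict_antimono_on {1..} (\<lambda>j. frac (real (n j) * \<alpha>))"
    and "(\<lambda>j. frac (real (n j) * \<alpha>)) \<longlonglongrightarrow> \<alpha>"
    and "frac (real (n 1) * \<alpha>) < \<beta> 1" and "\<beta> 1 < 1"
    and "\<forall>j>1. frac (real (n j) * \<alpha>) < \<beta> j \<and> \<beta> j < frac (real (n (j - 1)) * \<alpha>)"
    and "\<forall>j\<ge>1. \<beta> j \<notin> rat_span ({1, \<alpha>} \<union> \<beta> ` {1..<j})"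
  shows "minimal_system (Z_top \<alpha> n \<beta>) (F_map \<alpha>) \<and>
    (\<forall>\<rho>. compatible_metric (Z_top \<alpha> n \<beta>) \<rho> \<longrightarrow>
      Li_Yorke_pairs (Z_top \<alpha> n \<beta>) \<rho> (F_map \<alpha>) =
        pair_orbit (Z_set \<alpha> n \<beta>) (F_map \<alpha>) (z_plus0 \<alpha> n \<beta>) (z_minus \<alpha> n \<beta>) \<union>
        pair_orbit (Z_set \<alpha> n \<beta>) (F_map \<alpha>) (z_plus1 \<alpha> n \<beta>) (z_minus \<alpha> n \<beta>) \<and>
      countable (Li_Yorke_pairs (Z_top \<alpha> n \<beta>) \<rho> (F_map \<alpha>)) \<and>
      strong_Li_Yorke_pairs (Z_top \<alpha> n \<beta>) \<rho> (F_map \<alpha>) = {})"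
proof -
  interpret interval_coding \<alpha> n \<beta>
    by unfold_locales (use assms in auto)
  show ?thesis
  proof (intro conjI allI impI)
    show "minimal_system (Z_top \<alpha> n \<beta>) (F_map \<alpha>)" by (rule minimal)
    fix \<rho> assume "compatible_metric (Z_top \<alpha> n \<beta>) \<rho>"
    then interpret metrized_interval_coding \<alpha> n \<beta> \<rho> by unfold_locales
    show "Li_Yorke_pairs (Z_top \<alpha> n \<beta>) \<rho> (F_map \<alpha>) =
        pair_orbit (Z_set \<alpha> n \<beta>) (F_map \<alpha>) (z_plus0 \<alpha> n \<beta>) (z_minus \<alpha> n \<beta>) \<union>
        pair_orbit (Z_set \<alpha> n \<beta>) (F_map \<alpha>) (z_plus1 \<alpha> n \<beta>) (z_minus \<alpha> n \<beta>)"
      by (rule Li_Yorke_pairs_eq)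
    show "countable (Li_Yorke_pairs (Z_top \<alpha> n \<beta>) \<rho> (F_map \<alpha>))"
      by (rule countable_Li_Yorke_pairs)
    show "strong_Li_Yorke_pairs (Z_top \<alpha> n \<beta>) \<rho> (F_map \<alpha>) = {}"
      by (rule no_strong_Li_Yorke_pairs)
  qed
qed

end
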